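(* Assume that there exists a weight $2$ modular form $\chi\in M_2\subset R$ which is invertible in $R$. Then $$B^\Gamma=R^\Gamma(\!(u;D)\!)\qquad\text{and}\qquad B_0^{\Gamma}=R^\Gamma[[u;D]]$$ for $u=x\chi\in B^\Gamma$ and $D=-\chi^{-1}\partial_z$.
   Context: $\Gamma$ is a subgroup of $\mathrm{SL}(2,\mathbb{C})$ and $R$ is a commutative $\mathbb{C}$-algebra of functions in one variable $z$, which is a domain, such that: (i) $\Gamma$ acts on the right on $R$ by automorphisms $(f\cdot\gamma)(z)=f\left(\frac{az+b}{cz+d}\right)$ for $\gamma=\begin{pmatrix}a&b\\c&d\end{pmatrix}$; (ii) the function $z\mapsto cz+d$ is an invertible element of $R$ for every $\gamma\in\Gamma$; (iii) $R$ is stable under $\partial_z=\frac{d}{dz}$, which is nonzero on $R$. Put $d_z=-\partial_z$. For $k\in\mathbb{Z}$, $M_k=\{f\in R: f\left(\frac{az+b}{cz+d}\right)=(cz+d)^kf(z)\ \forall\gamma\in\Gamma\}$ (modular forms of weight $k$); $R^\Gamma=M_0$. The paper assumes $M_k\cap M_\ell=\{0\}$ for $k\neq\ell$. $B=R(\!(x;d_z)\!)$ is the ring of Laurent series $\sum_{i\ge m}f_ix^i$ ($m\in\mathbb{Z}$, $f_i\in R$) with $xf=\sum_{n\ge0}d_z^n(f)x^{n+1}$, equivalently $x^{-1}f=fx^{-1}+\partial_z(f)$; $B_0=R[[x;d_z]]$ is its subring of power series in $x$. The action of $\Gamma$ on $R$ extends to the action by automorphisms on $B$ given by $(x^{-1}|\gamma)=(cz+d)^2x^{-1}$,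 i.e. $(\sum f_nx^n|\gamma)=\sum(f_n\cdot\gamma)\bigl((cz+d)^2x^{-1}\bigr)^{-n}$. $B^\Gamma$ and $B_0^\Gamma$ are the invariant subrings. For a ring $S$ with a derivation $D$ (possibly zero), $S[[u;D]]$ (resp. $S(\!(u;D)\!)$) is the ring of power series (resp. Laurent series) in $u$ with left coefficients in $S$ and $uf=\sum_{n\ge0}D^n(f)u^{n+1}$ for $f\in S$. *)

theory Defs
  imports "HOL-Algebra.QuotRing" "HOL-Analysis.Analysis"
begin

section \<open>Skew Laurent series\<close>

text \<open>
  A series \<open>\<Sum>i. f i u^i\<close> with left coefficients in \<open>S\<close> is the function \<open>f :: int \<Rightarrow> 'a\<close>.
  The next three definitions are left multiplication by \<open>u\<close>, by \<open>u^-1\<close> and by \<open>u^i\<close>,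
  obtained termwise from \<open>u a = (\<Sum>n. D^n(a) u^(n+1))\<close> and the equivalent
  \<open>u^-1 a = a u^-1 - D(a)\<close>.  All index sets of finite sums below are finite for series whose
  support is bounded below.
\<close>

definition lmult_var :: "('a, 'm) ring_scheme \<Rightarrow> ('a \<Rightarrow> 'a) \<Rightarrow> (int \<Rightarrow> 'a) \<Rightarrow> int \<Rightarrow> 'a" where
  "lmult_var S D g =
     (\<lambda>k. \<Oplus>\<^bsub>S\<^esub>n \<in> {n::nat. g (k - 1 - int n) \<noteq> \<zero>\<^bsub>S\<^esub>}. (D ^^ n) (g (k - 1 - int n)))"

definition lmult_var_inv :: "('a, 'm) ring_scheme \<Rightarrow> ('a \<Rightarrow> 'a) \<Rightarrow> (int \<Rightarrow> 'a) \<Rightarrow> int \<Rightarrow> 'a" where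
  "lmult_var_inv S D g = (\<lambda>k. g (k + 1) \<ominus>\<^bsub>S\<^esub> D (g k))"

definition lmult_var_pow ::
    "('a, 'm) ring_scheme \<Rightarrow> ('a \<Rightarrow> 'a) \<Rightarrow> int \<Rightarrow> (int \<Rightarrow> 'a) \<Rightarrow> int \<Rightarrow> 'a" where
  "lmult_var_pow S D i =
     (if 0 \<le> i then lmult_var S D ^^ nat i else lmult_var_inv S D ^^ nat (- i))"

text \<open>The rings \<open>S((u; D))\<close> and \<open>S[[u; D]]\<close>.\<close>

definition skew_laurent :: "('a, 'm) ring_scheme \<Rightarrow> ('a \<Rightarrow> 'a) \<Rightarrow> (int \<Rightarrow> 'a) ring" where
  "skew_laurent S D =
     \<lparr>carrier = {f. (\<forall>i. f i \<in> carrier S) \<and> (\<exists>m. \<forall>i<m. f i = \<zero>\<^bsub>S\<^esub>)},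
      monoid.mult = (\<lambda>f g k. \<Oplus>\<^bsub>S\<^esub>i \<in> {i. f i \<noteq> \<zero>\<^bsub>S\<^esub> \<and> lmult_var_pow S D i g k \<noteq> \<zero>\<^bsub>S\<^esub>}.
                 f i \<otimes>\<^bsub>S\<^esub> lmult_var_pow S D i g k),
      one = (\<lambda>i. if i = 0 then \<one>\<^bsub>S\<^esub> else \<zero>\<^bsub>S\<^esub>),
      zero = (\<lambda>i. \<zero>\<^bsub>S\<^esub>),
      add = (\<lambda>f g i. f i \<oplus>\<^bsub>S\<^esub> g i)\<rparr>"

definition skew_power_series :: "('a, 'm) ring_scheme \<Rightarrow> ('a \<Rightarrow> 'a) \<Rightarrow> (int \<Rightarrow> 'a) ring" where
  "skew_power_series S D = (skew_laurent S D)
     \<lparr>carrier := {f \<in> carrier (skew_laurent S D). \<forall>i<0. f i = \<zero>\<^bsub>S\<^esub>}\<rparr>"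

definition series_monom :: "('a, 'm) ring_scheme \<Rightarrow> 'a \<Rightarrow> int \<Rightarrow> int \<Rightarrow> 'a" where
  "series_monom S a i = (\<lambda>k. if k = i then a else \<zero>\<^bsub>S\<^esub>)"

lemma skew_laurent_commutation:
  assumes "ring S" "a \<in> carrier S" "D \<in> carrier S \<rightarrow> carrier S" "D \<zero>\<^bsub>S\<^esub> = \<zero>\<^bsub>S\<^esub>" "\<one>\<^bsub>S\<^esub> \<noteq> \<zero>\<^bsub>S\<^esub>"
  shows "series_monom S \<one>\<^bsub>S\<^esub> 1 \<otimes>\<^bsub>skew_laurent S D\<^esub> series_monom S a 0 =
           (\<lambda>k. if 1 \<le> k then (D ^^ nat (k - 1)) a else \<zero>\<^bsub>S\<^esub>)"
proof
  fix k :: int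
  interpret ring S by fact
  have Dn: "(D ^^ n) a \<in> carrier S" for n
    by (induction n) (use assms in auto)
  have D0: "(D ^^ n) \<zero>\<^bsub>S\<^esub> = \<zero>\<^bsub>S\<^esub>" for n
    by (induction n) (use assms in auto)
  let ?h = "if 1 \<le> k then (D ^^ nat (k - 1)) a else \<zero>\<^bsub>S\<^esub>"
  have set1: "{n::nat. series_monom S a 0 (k - 1 - int n) \<noteq> \<zero>\<^bsub>S\<^esub>} =
      (if 1 \<le> k \<and> a \<noteq> \<zero>\<^bsub>S\<^esub> then {nat (k - 1)} else {})"
    by (auto simp: series_monom_def split: if_splits)
  have h: "lmult_var_pow S D 1 (series_monom S a 0) k = ?h"
    unfolding lmult_var_pow_def lmult_var_def using set1 Dn D0
    by (auto simp: series_monom_def)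
  have set2: "{i. series_monom S \<one>\<^bsub>S\<^esub> 1 i \<noteq> \<zero>\<^bsub>S\<^esub> \<and>
        lmult_var_pow S D i (series_monom S a 0) k \<noteq> \<zero>\<^bsub>S\<^esub>} = (if ?h = \<zero>\<^bsub>S\<^esub> then {} else {1})"
    using h assms(5) by (auto simp: series_monom_def split: if_splits)
  have hc: "?h \<in> carrier S" using Dn by simp
  show "(series_monom S \<one>\<^bsub>S\<^esub> 1 \<otimes>\<^bsub>skew_laurent S D\<^esub> series_monom S a 0) k = ?h"
  proof (cases "?h = \<zero>\<^bsub>S\<^esub>")
    case True
    then have "{i. series_monom S \<one>\<^bsub>S\<^esub> 1 i \<noteq> \<zero>\<^bsub>S\<^esub> \<and>
        lmult_var_pow S D i (series_monom S a 0) k \<noteq> \<zero>\<^bsub>S\<^esub>} = {}"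
      using set2 by simp
    then show ?thesis using True
      by (simp only: skew_laurent_def monoid.simps ring.simps partial_object.simps finsum_empty)
  next
    case False
    then have "{i. series_monom S \<one>\<^bsub>S\<^esub> 1 i \<noteq> \<zero>\<^bsub>S\<^esub> \<and>
        lmult_var_pow S D i (series_monom S a 0) k \<noteq> \<zero>\<^bsub>S\<^esub>} = {1}"
      using set2 by simp
    then have "(series_monom S \<one>\<^bsub>S\<^esub> 1 \<otimes>\<^bsub>skew_laurent S D\<^esub> series_monom S a 0) k =
        (\<Oplus>\<^bsub>S\<^esub>i\<in>{1}. series_monom S \<one>\<^bsub>S\<^esub> 1 i \<otimes>\<^bsub>S\<^esub>
            lmult_var_pow S D i (series_monom S a 0) k)"
      by (simp only: skew_laurent_def monoid.simps ring.simps partial_object.simps)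
    also have "\<dots> = \<one>\<^bsub>S\<^esub> \<otimes>\<^bsub>S\<^esub> ?h"
      using h hc by (simp add: series_monom_def)
    finally show ?thesis using hc by simp
  qed
qed

text \<open>Coefficientwise finite sums of families of series indexed by the integers.\<close>

definition series_summable :: "('a, 'm) ring_scheme \<Rightarrow> (int \<Rightarrow> int \<Rightarrow> 'a) \<Rightarrow> bool" where
  "series_summable S F \<longleftrightarrow> (\<forall>k. finite {n. F n k \<noteq> \<zero>\<^bsub>S\<^esub>})"

definition series_sum :: "('a, 'm) ring_scheme \<Rightarrow> (int \<Rightarrow> int \<Rightarrow> 'a) \<Rightarrow> int \<Rightarrow> 'a" where
  "series_sum S F = (\<lambda>k. \<Oplus>\<^bsub>S\<^esub>n \<in> {n. F n k \<noteq> \<zero>\<^bsub>S\<^esub>}. F n k)"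


section \<open>Algebras of functions of one complex variable with a modular action\<close>

definition SL2 :: "(complex^2^2) monoid" where
  "SL2 = \<lparr>carrier = {A. det A = 1}, monoid.mult = (**), one = mat 1\<rparr>"

definition denom :: "complex^2^2 \<Rightarrow> complex \<Rightarrow> complex" where
  "denom \<gamma> z = \<gamma> $ 2 $ 1 * z + \<gamma> $ 2 $ 2"

definition homography :: "complex^2^2 \<Rightarrow> complex \<Rightarrow> complex" where
  "homography \<gamma> z = (\<gamma> $ 1 $ 1 * z + \<gamma> $ 1 $ 2) / denom \<gamma> z"

text \<open>
  The functions are functions on an open set \<open>U\<close> that may be undefined at some points, such as
  the poles of a rational or meromorphic function, where Isabelle's total functions take
  irrelevant values.  Hence identities between functions are required to hold outside a countable
  subset of \<open>U\<close> only; unlike discreteness, countability of the exceptional set is stable under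
  homographies whose pole lies in \<open>U\<close>.  For continuous functions on \<open>U\<close> this is
  ordinary equality on \<open>U\<close>.
\<close>

definition fun_eq :: "complex set \<Rightarrow> (complex \<Rightarrow> complex) \<Rightarrow> (complex \<Rightarrow> complex) \<Rightarrow> bool" where
  "fun_eq U f g \<longleftrightarrow> countable {z \<in> U. f z \<noteq> g z}"

definition is_derivative ::
    "complex set \<Rightarrow> (complex \<Rightarrow> complex) \<Rightarrow> (complex \<Rightarrow> complex) \<Rightarrow> bool" where
  "is_derivative U f g \<longleftrightarrow> countable {z \<in> U. \<not> (f has_field_derivative g z) (at z)}"

text \<open>The element of \<open>R\<close> given by a function, the derivation \<open>d/dz\<close> of \<open>R\<close>, and the right
  action of a matrix on \<open>R\<close>.\<close>

definition elem_of ::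
    "complex set \<Rightarrow> (complex \<Rightarrow> complex) ring \<Rightarrow> (complex \<Rightarrow> complex) \<Rightarrow> complex \<Rightarrow> complex" where
  "elem_of U R h = (THE g. g \<in> carrier R \<and> fun_eq U g h)"

definition dz ::
    "complex set \<Rightarrow> (complex \<Rightarrow> complex) ring \<Rightarrow> (complex \<Rightarrow> complex) \<Rightarrow> complex \<Rightarrow> complex" where
  "dz U R f = (THE g. g \<in> carrier R \<and> is_derivative U f g)"

definition act :: "complex set \<Rightarrow> (complex \<Rightarrow> complex) ring \<Rightarrow> complex^2^2 \<Rightarrow>
    (complex \<Rightarrow> complex) \<Rightarrow> complex \<Rightarrow> complex" where
  "act U R \<gamma> f = elem_of U R (\<lambda>z. f (homography \<gamma> z))"

definition modular_forms :: "complex set \<Rightarrow> (complex \<Rightarrow> complex) ring \<Rightarrow> (complex^2^2) set \<Rightarrow>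
    int \<Rightarrow> (complex \<Rightarrow> complex) set" where
  "modular_forms U R \<Gamma> k =
     {f \<in> carrier R. \<forall>\<gamma>\<in>\<Gamma>. fun_eq U (\<lambda>z. f (homography \<gamma> z)) (\<lambda>z. denom \<gamma> z powi k * f z)}"

text \<open>
  Each element of \<open>R\<close> is represented by exactly one function in \<open>carrier R\<close> (assumption
  \<open>fun_eqD\<close>), and the ring operations are the pointwise ones in the above sense.  That the
  maps \<open>act U R \<gamma>\<close> are automorphisms and that \<open>dz U R\<close> is a derivation follows.
\<close>

locale modular_function_algebra =
  fixes U :: "complex set"
    and R :: "(complex \<Rightarrow> complex) ring" (structure)
    and \<Gamma> :: "(complex^2^2) set"
  assumes open_U: "open U"
    and domain_R: "domain R"
    and fun_eqD: "\<lbrakk>f \<in> carrier R; g \<in> carrier R; fun_eq U f g\<rbrakk> \<Longrightarrow> f = g"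
    and add_eq: "\<lbrakk>f \<in> carrier R; g \<in> carrier R\<rbrakk> \<Longrightarrow> fun_eq U (f \<oplus> g) (\<lambda>z. f z + g z)"
    and mult_eq: "\<lbrakk>f \<in> carrier R; g \<in> carrier R\<rbrakk> \<Longrightarrow> fun_eq U (f \<otimes> g) (\<lambda>z. f z * g z)"
    and const_mem: "\<exists>f\<in>carrier R. fun_eq U f (\<lambda>z. c)"
    and subgroup_\<Gamma>: "subgroup \<Gamma> SL2"
    and moebius_U: "\<gamma> \<in> \<Gamma> \<Longrightarrow> countable {z \<in> U. homography \<gamma> z \<notin> U}"
    and act_mem: "\<lbrakk>f \<in> carrier R; \<gamma> \<in> \<Gamma>\<rbrakk> \<Longrightarrow> \<exists>g\<in>carrier R. fun_eq U g (\<lambda>z. f (homography \<gamma> z))"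
    and denom_unit: "\<gamma> \<in> \<Gamma> \<Longrightarrow> \<exists>g\<in>Units R. fun_eq U g (denom \<gamma>)"
    and dz_mem: "f \<in> carrier R \<Longrightarrow> \<exists>g\<in>carrier R. is_derivative U f g"
    and dz_nonzero: "\<exists>f\<in>carrier R. dz U R f \<noteq> \<zero>"
    and weights_disjoint:
      "k \<noteq> l \<Longrightarrow> modular_forms U R \<Gamma> k \<inter> modular_forms U R \<Gamma> l = {\<zero>}"

definition invariant_ring :: "complex set \<Rightarrow> (complex \<Rightarrow> complex) ring \<Rightarrow> (complex^2^2) set \<Rightarrow>
    (complex \<Rightarrow> complex) ring" where
  "invariant_ring U R \<Gamma> = R\<lparr>carrier := modular_forms U R \<Gamma> 0\<rparr>"


section \<open>Formal pseudodifferential operators and their invariants\<close>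

definition pdo :: "complex set \<Rightarrow> (complex \<Rightarrow> complex) ring \<Rightarrow>
    (int \<Rightarrow> complex \<Rightarrow> complex) ring" where
  "pdo U R = skew_laurent R (\<lambda>f. \<ominus>\<^bsub>R\<^esub> dz U R f)"

definition pdo0 :: "complex set \<Rightarrow> (complex \<Rightarrow> complex) ring \<Rightarrow>
    (int \<Rightarrow> complex \<Rightarrow> complex) ring" where
  "pdo0 U R = skew_power_series R (\<lambda>f. \<ominus>\<^bsub>R\<^esub> dz U R f)"

text \<open>\<open>(x^-1 | \<gamma>) = (c z + d)^2 x^-1\<close>\<close>

definition act_xinv :: "complex set \<Rightarrow> (complex \<Rightarrow> complex) ring \<Rightarrow> complex^2^2 \<Rightarrow>
    int \<Rightarrow> complex \<Rightarrow> complex" where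
  "act_xinv U R \<gamma> = series_monom R (elem_of U R (denom \<gamma>) [^]\<^bsub>R\<^esub> (2::nat)) (-1)"

definition pdo_act :: "complex set \<Rightarrow> (complex \<Rightarrow> complex) ring \<Rightarrow> complex^2^2 \<Rightarrow>
    (int \<Rightarrow> complex \<Rightarrow> complex) \<Rightarrow> int \<Rightarrow> complex \<Rightarrow> complex" where
  "pdo_act U R \<gamma> b = series_sum R
     (\<lambda>n. series_monom R (act U R \<gamma> (b n)) 0 \<otimes>\<^bsub>pdo U R\<^esub> (act_xinv U R \<gamma> [^]\<^bsub>pdo U R\<^esub> (- n)))"

definition pdo_invariants :: "complex set \<Rightarrow> (complex \<Rightarrow> complex) ring \<Rightarrow> (complex^2^2) set \<Rightarrow>
    (int \<Rightarrow> complex \<Rightarrow> complex) ring" where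
  "pdo_invariants U R \<Gamma> =
     (pdo U R)\<lparr>carrier := {b \<in> carrier (pdo U R). \<forall>\<gamma>\<in>\<Gamma>. pdo_act U R \<gamma> b = b}\<rparr>"

definition pdo0_invariants :: "complex set \<Rightarrow> (complex \<Rightarrow> complex) ring \<Rightarrow> (complex^2^2) set \<Rightarrow>
    (int \<Rightarrow> complex \<Rightarrow> complex) ring" where
  "pdo0_invariants U R \<Gamma> =
     (pdo0 U R)\<lparr>carrier := {b \<in> carrier (pdo0 U R). \<forall>\<gamma>\<in>\<Gamma>. pdo_act U R \<gamma> b = b}\<rparr>"

text \<open>The terms \<open>f i u^i\<close> in \<open>pdo U R\<close> of a Laurent series in \<open>u\<close>, and their sum.\<close>

definition expansion_term :: "complex set \<Rightarrow> (complex \<Rightarrow> complex) ring \<Rightarrow>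
    (int \<Rightarrow> complex \<Rightarrow> complex) \<Rightarrow> (int \<Rightarrow> complex \<Rightarrow> complex) \<Rightarrow>
    int \<Rightarrow> int \<Rightarrow> complex \<Rightarrow> complex" where
  "expansion_term U R u f i = series_monom R (f i) 0 \<otimes>\<^bsub>pdo U R\<^esub> (u [^]\<^bsub>pdo U R\<^esub> i)"

definition expansion :: "complex set \<Rightarrow> (complex \<Rightarrow> complex) ring \<Rightarrow>
    (int \<Rightarrow> complex \<Rightarrow> complex) \<Rightarrow> (int \<Rightarrow> complex \<Rightarrow> complex) \<Rightarrow>
    int \<Rightarrow> complex \<Rightarrow> complex" where
  "expansion U R u f = series_sum R (expansion_term U R u f)"

end

theory Submission imports Defs "HOL-Algebra.Subrings" begin

text \<open>
  Write \<open>B = R((x; d))\<close> with \<open>d = -d/dz\<close>, so that \<open>x^-1 f = f x^-1 - d f\<close>.  Since \<open>\<chi>\<close> is a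
  unit, \<open>u = x \<chi>\<close> has the inverse \<open>u^-1 = \<chi>^-1 x^-1\<close>, and multiplying the commutation rule by
  \<open>\<chi>^-1\<close> gives \<open>u^-1 f = f u^-1 - D f\<close>.  Thus \<open>u\<close> obeys the relation that defines \<open>R((u; D))\<close>,
  and as \<open>x\<close> can be recovered from \<open>u\<close> in the same way with \<open>\<chi>\<close> in place of \<open>\<chi>^-1\<close>, expanding in
  powers of \<open>u\<close> identifies \<open>R((u; D))\<close> with \<open>B\<close>.  The point of the weight \<open>2\<close> is that \<open>u\<close> is
  invariant: both \<open>\<chi>\<close> and \<open>x^-1\<close> are multiplied by \<open>(c z + d)^2\<close>, which cancels in \<open>\<chi>^-1 x^-1\<close>.
  Consequently \<open>\<Gamma>\<close> acts on \<open>\<Sum>i. f i u^i\<close> through the coefficients \<open>f i\<close> alone, and the series is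
  invariant if and only if every \<open>f i\<close> lies in \<open>R\<^sup>\<Gamma>\<close>.  Both \<open>u\<close> and \<open>u^-1\<close> respect the order of
  vanishing in \<open>x\<close>, so power series correspond to power series.

  Every map in this argument (the expansion, its inverse, and the action of a matrix) is an
  instance of one construction: given a ring homomorphism \<open>\<phi>\<close> and a unit \<open>w\<close> of order \<open>1\<close> with
  \<open>w^-1 \<phi>(a) = \<phi>(a) w^-1 - \<phi>(D a)\<close>, the map \<open>\<Sum>i. f i u^i \<mapsto> \<Sum>i. \<phi>(f i) w^i\<close> is a ring
  homomorphism (\<open>subst_hom\<close>).  Identities between such maps are never checked on infinite sums:
  an additive map that shifts the order of series by a bounded amount is determined by its
  values on monomials (\<open>filtered_additive_eqI\<close>), hence a homomorphism of this kind by its values on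
  constants and on \<open>u^-1\<close> (\<open>filtered_hom_eqI\<close>).  The same principle yields the associativity
  of the multiplication of skew Laurent series.

  What remains is about functions: that \<open>d/dz\<close> is a derivation, that the action is by
  automorphisms, and the chain rule \<open>(c z + d)^2 (f|\<gamma>)' = f'|\<gamma>\<close>, all up to countable sets
  (\<open>dz_mult\<close>, \<open>act_hom\<close>, \<open>dz_act\<close>).
\<close>

section \<open>Filtered additive maps between groups of Laurent series\<close>

definition series_from :: "('a, 'm) ring_scheme \<Rightarrow> int \<Rightarrow> (int \<Rightarrow> 'a) set" where
  "series_from S m = {f. (\<forall>i. f i \<in> carrier S) \<and> (\<forall>i<m. f i = \<zero>\<^bsub>S\<^esub>)}"

definition laurent_series :: "('a, 'm) ring_scheme \<Rightarrow> (int \<Rightarrow> 'a) set" where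
  "laurent_series S = (\<Union>m. series_from S m)"

definition series_add :: "('a, 'm) ring_scheme \<Rightarrow> (int \<Rightarrow> 'a) \<Rightarrow> (int \<Rightarrow> 'a) \<Rightarrow> int \<Rightarrow> 'a" where
  "series_add S f g = (\<lambda>i. f i \<oplus>\<^bsub>S\<^esub> g i)"

definition series_smult :: "('a, 'm) ring_scheme \<Rightarrow> 'a \<Rightarrow> (int \<Rightarrow> 'a) \<Rightarrow> int \<Rightarrow> 'a" where
  "series_smult S a g = (\<lambda>i. a \<otimes>\<^bsub>S\<^esub> g i)"

text \<open>
  The bound on the shift is continuity for the topology given by the order of series, in a form
  that is stable under composition.
\<close>

definition filtered_additive ::
    "('a, 'm) ring_scheme \<Rightarrow> ('b, 'n) ring_scheme \<Rightarrow> ((int \<Rightarrow> 'a) \<Rightarrow> int \<Rightarrow> 'b) \<Rightarrow> bool" where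
  "filtered_additive S T F \<longleftrightarrow>
     (\<forall>f\<in>laurent_series S. \<forall>g\<in>laurent_series S.
        F (series_add S f g) = series_add T (F f) (F g)) \<and>
     (\<exists>c. \<forall>m. \<forall>f\<in>series_from S m. F f \<in> series_from T (m + c))"

lemma skew_laurent_simps:
  "carrier (skew_laurent S D) = laurent_series S"
  "f \<oplus>\<^bsub>skew_laurent S D\<^esub> g = series_add S f g"
  "\<one>\<^bsub>skew_laurent S D\<^esub> = series_monom S \<one>\<^bsub>S\<^esub> 0"
  "\<zero>\<^bsub>skew_laurent S D\<^esub> = (\<lambda>i. \<zero>\<^bsub>S\<^esub>)"
  by (auto simp: skew_laurent_def laurent_series_def series_from_def series_add_def
      series_monom_def)

lemma series_from_mono: "m \<le> n \<Longrightarrow> series_from S n \<subseteq> series_from S m"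
  by (auto simp: series_from_def)

lemma series_from_laurent: "f \<in> series_from S m \<Longrightarrow> f \<in> laurent_series S"
  by (auto simp: laurent_series_def)

lemma laurent_seriesE:
  assumes "f \<in> laurent_series S" obtains m where "f \<in> series_from S m"
  using assms by (auto simp: laurent_series_def)

lemma series_coeff_closed: "f \<in> laurent_series S \<Longrightarrow> f i \<in> carrier S"
  by (auto simp: laurent_series_def series_from_def)

lemma filtered_additiveI:
  assumes "\<And>f g. \<lbrakk>f \<in> laurent_series S; g \<in> laurent_series S\<rbrakk> \<Longrightarrow>
      F (series_add S f g) = series_add T (F f) (F g)"
    and "\<And>m f. f \<in> series_from S m \<Longrightarrow> F f \<in> series_from T (m + c)"
  shows "filtered_additive S T F"
  using assms unfolding filtered_additive_def by blast

lemma filtered_additive_add: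
  "\<lbrakk>filtered_additive S T F; f \<in> laurent_series S; g \<in> laurent_series S\<rbrakk> \<Longrightarrow>
     F (series_add S f g) = series_add T (F f) (F g)"
  unfolding filtered_additive_def by blast

lemma filtered_additive_closed:
  "\<lbrakk>filtered_additive S T F; f \<in> laurent_series S\<rbrakk> \<Longrightarrow> F f \<in> laurent_series T"
  unfolding filtered_additive_def laurent_series_def by blast

lemma filtered_additive_compose:
  assumes F: "filtered_additive S T F" and G: "filtered_additive T V G"
  shows "filtered_additive S V (\<lambda>f. G (F f))"
proof -
  from F obtain c where c: "\<And>m f. f \<in> series_from S m \<Longrightarrow> F f \<in> series_from T (m + c)"
    unfolding filtered_additive_def by blast
  from G obtain d where d: "\<And>m f. f \<in> series_from T m \<Longrightarrow> G f \<in> series_from V (m + d)"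
    unfolding filtered_additive_def by blast
  show ?thesis
  proof (rule filtered_additiveI)
    show "G (F (series_add S f g)) = series_add V (G (F f)) (G (F g))"
      if "f \<in> laurent_series S" "g \<in> laurent_series S" for f g
      using that by (simp add: filtered_additive_add[OF F] filtered_additive_add[OF G]
          filtered_additive_closed[OF F])
    show "G (F f) \<in> series_from V (m + (c + d))" if "f \<in> series_from S m" for m f
      using d[OF c[OF that]] by (simp add: add.assoc)
  qed
qed

lemma filtered_additive_id: "filtered_additive S S (\<lambda>f. f)"
  by (rule filtered_additiveI[where c = 0]) auto

context ring
begin

lemma series_monom_from: "a \<in> carrier R \<Longrightarrow> series_monom R a i \<in> series_from R i"
  by (auto simp: series_monom_def series_from_def)

lemma series_monom_laurent [simp]: "a \<in> carrier R \<Longrightarrow> series_monom R a i \<in> laurent_series R"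
  using series_monom_from series_from_laurent by blast

lemma series_add_from:
  "\<lbrakk>f \<in> series_from R m; g \<in> series_from R m\<rbrakk> \<Longrightarrow> series_add R f g \<in> series_from R m"
  by (auto simp: series_add_def series_from_def)

lemma laurent_series_common:
  assumes "f \<in> laurent_series R" "g \<in> laurent_series R"
  obtains m where "f \<in> series_from R m" "g \<in> series_from R m"
proof -
  obtain m n where "f \<in> series_from R m" "g \<in> series_from R n"
    using assms by (auto simp: laurent_series_def)
  then have "f \<in> series_from R (min m n)" "g \<in> series_from R (min m n)"
    by (auto simp: series_from_def)
  then show thesis by (rule that)
qed

lemma series_add_laurent [simp]:
  "\<lbrakk>f \<in> laurent_series R; g \<in> laurent_series R\<rbrakk> \<Longrightarrow> series_add R f g \<in> laurent_series R"
  by (metis laurent_series_common series_add_from series_from_laurent)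

lemma series_from_split:
  assumes "f \<in> series_from R m"
  obtains g where "g \<in> series_from R (m + 1)" "f = series_add R (series_monom R (f m) m) g"
proof
  show "(\<lambda>i. if i \<le> m then \<zero> else f i) \<in> series_from R (m + 1)"
    using assms by (auto simp: series_from_def)
  show "f = series_add R (series_monom R (f m) m) (\<lambda>i. if i \<le> m then \<zero> else f i)"
    using assms by (auto simp: series_from_def series_add_def series_monom_def)
qed

lemma filtered_additive_smult:
  assumes "a \<in> carrier R"
  shows "filtered_additive R R (series_smult R a)"
  by (rule filtered_additiveI[where c = 0])
    (use assms in \<open>auto simp: series_smult_def series_add_def series_from_def r_distr
        series_coeff_closed\<close>)

end

text \<open>
  Modulo series of high order, a Laurent series is a finite sum of monomials.  Since both maps
  shift the order by at least a fixed \<open>c\<close>, a coefficient of the image only sees such a finite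
  part of the argument.
\<close>

lemma filtered_additive_eqI:
  assumes S: "ring S" and F: "filtered_additive S T F" and G: "filtered_additive S T G"
    and eq: "\<And>a i. a \<in> carrier S \<Longrightarrow> F (series_monom S a i) = G (series_monom S a i)"
    and f: "f \<in> laurent_series S"
  shows "F f = G f"
proof
  fix k
  interpret S: ring S by fact
  from F obtain c1 where "\<And>m f. f \<in> series_from S m \<Longrightarrow> F f \<in> series_from T (m + c1)"
    unfolding filtered_additive_def by blast
  moreover from G obtain c2 where "\<And>m f. f \<in> series_from S m \<Longrightarrow> G f \<in> series_from T (m + c2)"
    unfolding filtered_additive_def by blast
  ultimately have low: "F g k = \<zero>\<^bsub>T\<^esub>" "G g k = \<zero>\<^bsub>T\<^esub>"
    if "g \<in> series_from S m" "k - min c1 c2 < m" for g m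
    using that unfolding series_from_def by fastforce+
  (* Series in series_from S N contribute nothing to the coefficient k of either image. *)
  define N where "N = k - min c1 c2 + 1"
  have "F f k = G f k" if "f \<in> series_from S (N - int n)" for n f
    using that
  proof (induction n arbitrary: f)
    case 0
    then show ?case using low[of f N] by (simp add: N_def)
  next
    case (Suc n)
    define m where "m = N - int (Suc n)"
    have f: "f \<in> series_from S m" using Suc.prems by (simp add: m_def)
    then obtain g where g: "g \<in> series_from S (m + 1)"
      "f = series_add S (series_monom S (f m) m) g"
      by (rule S.series_from_split)
    have fm: "f m \<in> carrier S" using f by (simp add: series_from_def)
    have "F g k = G g k" using Suc.IH[of g] g(1) by (simp add: m_def algebra_simps)
    moreover have "H f = series_add T (H (series_monom S (f m) m)) (H g)"
      if "filtered_additive S T H" for H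
      using filtered_additive_add[OF that S.series_monom_laurent[OF fm, of m]
          series_from_laurent[OF g(1)]] unfolding g(2)[symmetric] .
    ultimately show ?case
      using F G eq[OF fm, of m] by (metis series_add_def)
  qed
  moreover obtain m where "f \<in> series_from S m" using f by (rule laurent_seriesE)
  moreover have "N - int (nat (N - m)) \<le> m" by simp
  ultimately show "F f k = G f k" using series_from_mono by blast
qed

section \<open>The ring of skew Laurent series\<close>

locale skew_coefficients = ring S for S (structure) +
  fixes D
  assumes D_closed [simp]: "a \<in> carrier S \<Longrightarrow> D a \<in> carrier S"
    and D_add: "\<lbrakk>a \<in> carrier S; b \<in> carrier S\<rbrakk> \<Longrightarrow> D (a \<oplus> b) = D a \<oplus> D b"
    and D_mult: "\<lbrakk>a \<in> carrier S; b \<in> carrier S\<rbrakk> \<Longrightarrow> D (a \<otimes> b) = D a \<otimes> b \<oplus> a \<otimes> D b"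
begin

abbreviation L where "L \<equiv> skew_laurent S D"
abbreviation X where "X \<equiv> lmult_var S D"
abbreviation Y where "Y \<equiv> lmult_var_inv S D"
abbreviation P where "P \<equiv> lmult_var_pow S D"

lemma D_zero [simp]: "D \<zero> = \<zero>"
  using D_add[of \<zero> \<zero>] by (metis D_closed add.l_cancel_one' l_zero zero_closed)

lemma D_one [simp]: "D \<one> = \<zero>"
  using D_mult[of \<one> \<one>] by (metis D_closed add.l_cancel_one' l_one one_closed r_one)

lemma D_funpow_closed [simp]: "a \<in> carrier S \<Longrightarrow> (D ^^ n) a \<in> carrier S"
  by (induction n) auto

lemma D_funpow_zero [simp]: "(D ^^ n) \<zero> = \<zero>"
  by (induction n) auto

lemma D_finsum:
  "\<lbrakk>finite A; f \<in> A \<rightarrow> carrier S\<rbrakk> \<Longrightarrow> D (\<Oplus>i\<in>A. f i) = (\<Oplus>i\<in>A. D (f i))"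
  by (induction A rule: finite_induct) (auto simp: D_add Pi_def)

lemma Y_from: "g \<in> series_from S m \<Longrightarrow> Y g \<in> series_from S (m - 1)"
  by (auto simp: series_from_def lmult_var_inv_def minus_eq)

lemma filtered_additive_Y: "filtered_additive S S Y"
proof (rule filtered_additiveI)
  show "Y g \<in> series_from S (m + -1)" if "g \<in> series_from S m" for g m
    using Y_from[OF that] by simp
  show "Y (series_add S f g) = series_add S (Y f) (Y g)"
    if "f \<in> laurent_series S" "g \<in> laurent_series S" for f g
    using that by (auto simp: lmult_var_inv_def series_add_def D_add minus_eq
        series_coeff_closed minus_add a_ac)
qed

text \<open>
  If \<open>Y f = Y g\<close>, each coefficient of \<open>f - g\<close> is the image under \<open>D\<close> of the preceding one, and the
  coefficients vanish far enough to the left.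
\<close>

lemma Y_inj:
  assumes f: "f \<in> laurent_series S" and g: "g \<in> laurent_series S" and eq: "Y f = Y g"
  shows "f = g"
proof
  fix k
  obtain m where m: "f \<in> series_from S m" "g \<in> series_from S m"
    using f g by (rule laurent_series_common)
  have "f k = g k" if "m \<le> k"
    using that
  proof (induction k rule: int_ge_induct)
    case base
    have "Y f (m - 1) = Y g (m - 1)" using eq by simp
    then show ?case using m by (simp add: lmult_var_inv_def series_from_def minus_eq)
  next
    case (step i)
    have "Y f i = Y g i" using eq by simp
    then show ?case using step series_coeff_closed[OF f] series_coeff_closed[OF g]
      by (simp add: lmult_var_inv_def minus_eq)
  qed
  then show "f k = g k" using m by (cases "m \<le> k") (auto simp: series_from_def)
qed

lemma X_coeff:
  assumes g: "g \<in> series_from S m" and n: "k \<le> m + int n"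
  shows "X g k = (\<Oplus>i\<in>{..<n}. (D ^^ i) (g (k - 1 - int i)))"
  unfolding lmult_var_def
proof (rule add.finprod_mono_neutral_cong_left)
  have *: "g (k - 1 - int i) = \<zero>" if "\<not> i < n" for i
    using g n that by (simp add: series_from_def)
  then show "{i. g (k - 1 - int i) \<noteq> \<zero>} \<subseteq> {..<n}" by blast
qed (use g in \<open>auto simp: series_from_def\<close>)

lemma X_from:
  assumes g: "g \<in> series_from S m" shows "X g \<in> series_from S (m + 1)"
proof -
  have "X g k \<in> carrier S" for k
  proof -
    have "k \<le> m + int (nat (k - m))" by simp
    then show ?thesis
      unfolding X_coeff[OF g \<open>k \<le> m + int (nat (k - m))\<close>]
      by (intro finsum_closed) (use g in \<open>auto simp: series_from_def\<close>)
  qed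
  moreover have "X g k = \<zero>" if "k < m + 1" for k
    using X_coeff[OF g, of k 0] that by simp
  ultimately show ?thesis by (simp add: series_from_def)
qed

lemma X_closed [simp]: "g \<in> laurent_series S \<Longrightarrow> X g \<in> laurent_series S"
  by (meson X_from laurent_seriesE series_from_laurent)

lemma Y_closed [simp]: "g \<in> laurent_series S \<Longrightarrow> Y g \<in> laurent_series S"
  by (rule filtered_additive_closed[OF filtered_additive_Y])

text \<open>
  Left multiplication by \<open>u^-1\<close> is given by a two-term formula and is easily seen to be
  compatible with products; the series formula for left multiplication by \<open>u\<close> enters only
  through this lemma, a telescoping sum.
\<close>

lemma Y_X: assumes "g \<in> laurent_series S" shows "Y (X g) = g"
proof
  fix k
  obtain m where g: "g \<in> series_from S m" using assms by (rule laurent_seriesE)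
  define n where "n = nat (k - m)"
  have n: "k \<le> m + int n" by (simp add: n_def)
  have gc: "g i \<in> carrier S" for i using g by (simp add: series_from_def)
  have "X g (k + 1) = (\<Oplus>i\<in>{..n}. (D ^^ i) (g (k - int i)))"
    using X_coeff[OF g, of "k + 1" "Suc n"] n by (simp add: lessThan_Suc_atMost)
  also have "\<dots> = (\<Oplus>i\<in>{..<n}. D ((D ^^ i) (g (k - 1 - int i)))) \<oplus> g k"
  proof (cases n)
    case 0
    then show ?thesis using gc by simp
  next
    case (Suc l)
    then show ?thesis
      using gc by (simp add: finsum_Suc2 lessThan_Suc_atMost diff_diff_add del: finsum_Suc)
  qed
  also have "(\<Oplus>i\<in>{..<n}. D ((D ^^ i) (g (k - 1 - int i)))) = D (X g k)"
    using gc by (simp add: X_coeff[OF g n] D_finsum)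
  finally have "X g (k + 1) = D (X g k) \<oplus> g k" .
  then show "Y (X g) k = g k"
    using gc series_coeff_closed[OF X_closed[OF assms]]
    by (simp add: lmult_var_inv_def minus_eq a_ac r_neg1)
      (metis D_closed a_comm a_inv_closed add.m_lcomm r_neg r_zero)
qed

lemma X_Y: "g \<in> laurent_series S \<Longrightarrow> X (Y g) = g"
  by (rule Y_inj) (simp_all add: Y_X)

lemma X_eqI: "\<lbrakk>g \<in> laurent_series S; Y g = f\<rbrakk> \<Longrightarrow> X f = g"
  using X_Y by blast

lemma filtered_additive_X: "filtered_additive S S X"
proof (rule filtered_additiveI)
  show "X (series_add S f g) = series_add S (X f) (X g)"
    if "f \<in> laurent_series S" "g \<in> laurent_series S" for f g
    by (rule X_eqI) (use that in \<open>simp_all add: filtered_additive_add[OF filtered_additive_Y] Y_X\<close>)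
qed (rule X_from)

lemma P_0 [simp]: "P 0 g = g"
  by (simp add: lmult_var_pow_def)

lemma P_closed [simp]: "g \<in> laurent_series S \<Longrightarrow> P i g \<in> laurent_series S"
proof -
  assume g: "g \<in> laurent_series S"
  have "(X ^^ n) g \<in> laurent_series S" for n by (induction n) (use g in auto)
  moreover have "(Y ^^ n) g \<in> laurent_series S" for n by (induction n) (use g in auto)
  ultimately show ?thesis by (simp add: lmult_var_pow_def)
qed

lemma Y_P: assumes "g \<in> laurent_series S" shows "Y (P i g) = P (i - 1) g"
proof (cases "0 < i")
  case True
  then obtain n where n: "i = 1 + int n" by (metis zless_iff_Suc_zadd add_0 of_nat_Suc)
  have "P i g = X (P (i - 1) g)"
    using n by (simp add: lmult_var_pow_def nat_add_distrib)
  then show ?thesis using assms by (simp add: Y_X)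
next
  case False
  then obtain n where n: "i = - int n" by (metis not_less nonpos_int_cases)
  have neg: "P (- int n) g = (Y ^^ n) g" for n
    by (cases "n = 0") (simp_all add: lmult_var_pow_def)
  have "i - 1 = - int (Suc n)" using n by simp
  then show ?thesis using n by (simp only: neg funpow.simps o_apply)
qed

lemma X_P: "g \<in> laurent_series S \<Longrightarrow> X (P i g) = P (i + 1) g"
  by (rule X_eqI) (simp_all add: Y_P)

lemma P_induct [consumes 1, case_names zero X Y]:
  assumes "g \<in> laurent_series S" and "Q 0 g"
    and "\<And>i. Q i (P i g) \<Longrightarrow> Q (i + 1) (X (P i g))"
    and "\<And>i. Q i (P i g) \<Longrightarrow> Q (i - 1) (Y (P i g))"
  shows "Q i (P i g)"
proof (induction i rule: int_induct[where k = 0])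
  case base then show ?case using assms(2) by simp
next
  case (step1 i) then show ?case using assms(1,3) by (simp add: X_P)
next
  case (step2 i) then show ?case using assms(1,4) by (simp add: Y_P)
qed

lemma P_from: assumes g: "g \<in> series_from S m" shows "P i g \<in> series_from S (m + i)"
proof (rule P_induct[where Q = "\<lambda>i h. h \<in> series_from S (m + i)"])
  show "X (P i g) \<in> series_from S (m + (i + 1))" if "P i g \<in> series_from S (m + i)" for i
    using X_from[OF that] by (simp add: add.assoc)
  show "Y (P i g) \<in> series_from S (m + (i - 1))" if "P i g \<in> series_from S (m + i)" for i
    using Y_from[OF that] by (simp add: algebra_simps)
qed (use g series_from_laurent in auto)

lemma filtered_additive_P: "filtered_additive S S (P i)"
proof (rule filtered_additiveI)
  fix f g assume fg: "f \<in> laurent_series S" "g \<in> laurent_series S"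
  show "P i (series_add S f g) = series_add S (P i f) (P i g)"
    by (rule P_induct[where Q = "\<lambda>i h. h = series_add S (P i f) (P i g)"])
      (use fg in \<open>simp_all add: X_P Y_P filtered_additive_add[OF filtered_additive_X]
        filtered_additive_add[OF filtered_additive_Y]\<close>)
qed (rule P_from)

text \<open>
  The index set in the definition of the product depends on which terms vanish.  Any finite set
  containing \<open>{m..k - n}\<close> may replace it, so that several products can be summed over a
  common set.
\<close>

lemma mult_coeff:
  assumes f: "f \<in> series_from S m" and g: "g \<in> series_from S n"
    and A: "finite A" "{m..k - n} \<subseteq> A"
  shows "(f \<otimes>\<^bsub>L\<^esub> g) k = (\<Oplus>i\<in>A. f i \<otimes> P i g k)"
proof -
  have P: "P i g k \<in> carrier S" for i
    using P_from[OF g] by (simp add: series_from_def)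
  have f': "f i \<in> carrier S" for i using f by (simp add: series_from_def)
  have out: "f i = \<zero> \<or> P i g k = \<zero>" if "i \<notin> A" for i
  proof -
    have "i < m \<or> k - n < i" using that A(2) by (meson atLeastAtMost_iff not_le subsetD)
    then show ?thesis
      using f P_from[OF g, of i] unfolding series_from_def by (auto simp: add.commute)
  qed
  have "(f \<otimes>\<^bsub>L\<^esub> g) k = (\<Oplus>i\<in>{i. f i \<noteq> \<zero> \<and> P i g k \<noteq> \<zero>}. f i \<otimes> P i g k)"
    by (simp add: skew_laurent_def)
  also have "\<dots> = (\<Oplus>i\<in>A. f i \<otimes> P i g k)"
    by (rule add.finprod_mono_neutral_cong_left) (use A(1) out f' P in auto)
  finally show ?thesis .
qed

lemma mult_from:
  assumes f: "f \<in> series_from S m" and g: "g \<in> series_from S n"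
  shows "f \<otimes>\<^bsub>L\<^esub> g \<in> series_from S (m + n)"
proof -
  have "P i g k \<in> carrier S" "f i \<in> carrier S" for i k
    using P_from[OF g] f by (simp_all add: series_from_def)
  then have "(f \<otimes>\<^bsub>L\<^esub> g) k \<in> carrier S" for k
    by (subst mult_coeff[OF f g _ order_refl]) (auto intro!: finsum_closed)
  moreover have "(f \<otimes>\<^bsub>L\<^esub> g) k = \<zero>" if "k < m + n" for k
    using mult_coeff[OF f g, of "{}" k] that by simp
  ultimately show ?thesis by (simp add: series_from_def)
qed

lemma mult_closed [simp]:
  "\<lbrakk>f \<in> laurent_series S; g \<in> laurent_series S\<rbrakk> \<Longrightarrow> f \<otimes>\<^bsub>L\<^esub> g \<in> laurent_series S"
  by (meson laurent_seriesE mult_from series_from_laurent)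

lemma filtered_additive_mult_left:
  assumes g: "g \<in> laurent_series S"
  shows "filtered_additive S S (\<lambda>f. f \<otimes>\<^bsub>L\<^esub> g)"
proof -
  obtain n where n: "g \<in> series_from S n" using g by (rule laurent_seriesE)
  show ?thesis
  proof (rule filtered_additiveI)
    show "f \<otimes>\<^bsub>L\<^esub> g \<in> series_from S (m + n)" if "f \<in> series_from S m" for f m
      using that n by (rule mult_from)
    fix f h assume "f \<in> laurent_series S" "h \<in> laurent_series S"
    then obtain m where fh: "f \<in> series_from S m" "h \<in> series_from S m"
      by (rule laurent_series_common)
    show "series_add S f h \<otimes>\<^bsub>L\<^esub> g = series_add S (f \<otimes>\<^bsub>L\<^esub> g) (h \<otimes>\<^bsub>L\<^esub> g)"
    proof
      fix k
      have [simp]: "f i \<in> carrier S" "h i \<in> carrier S" "P i g k \<in> carrier S" for i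
        using fh P_from[OF n] by (simp_all add: series_from_def)
      show "(series_add S f h \<otimes>\<^bsub>L\<^esub> g) k = series_add S (f \<otimes>\<^bsub>L\<^esub> g) (h \<otimes>\<^bsub>L\<^esub> g) k"
        unfolding series_add_def[of S "f \<otimes>\<^bsub>L\<^esub> g"]
          mult_coeff[OF series_add_from[OF fh] n finite_atLeastAtMost_int order_refl]
          mult_coeff[OF fh(1) n finite_atLeastAtMost_int order_refl]
          mult_coeff[OF fh(2) n finite_atLeastAtMost_int order_refl]
        by (simp add: series_add_def l_distr finsum_addf)
    qed
  qed
qed

lemma filtered_additive_mult_right:
  assumes f: "f \<in> laurent_series S"
  shows "filtered_additive S S (\<lambda>g. f \<otimes>\<^bsub>L\<^esub> g)"
proof -
  obtain m where m: "f \<in> series_from S m" using f by (rule laurent_seriesE)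
  show ?thesis
  proof (rule filtered_additiveI)
    show "f \<otimes>\<^bsub>L\<^esub> g \<in> series_from S (n + m)" if "g \<in> series_from S n" for g n
      using mult_from[OF m that] by (simp add: add.commute)
    fix g h assume gh': "g \<in> laurent_series S" "h \<in> laurent_series S"
    then obtain n where gh: "g \<in> series_from S n" "h \<in> series_from S n"
      by (rule laurent_series_common)
    show "f \<otimes>\<^bsub>L\<^esub> series_add S g h = series_add S (f \<otimes>\<^bsub>L\<^esub> g) (f \<otimes>\<^bsub>L\<^esub> h)"
    proof
      fix k
      have [simp]: "f i \<in> carrier S" "P i g k \<in> carrier S" "P i h k \<in> carrier S" for i
        using m P_from[OF gh(1)] P_from[OF gh(2)] by (simp_all add: series_from_def)
      show "(f \<otimes>\<^bsub>L\<^esub> series_add S g h) k = series_add S (f \<otimes>\<^bsub>L\<^esub> g) (f \<otimes>\<^bsub>L\<^esub> h) k"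
        unfolding series_add_def[of S "f \<otimes>\<^bsub>L\<^esub> g"]
          mult_coeff[OF m series_add_from[OF gh] finite_atLeastAtMost_int order_refl]
          mult_coeff[OF m gh(1) finite_atLeastAtMost_int order_refl]
          mult_coeff[OF m gh(2) finite_atLeastAtMost_int order_refl]
          filtered_additive_add[OF filtered_additive_P gh']
        by (simp add: series_add_def r_distr finsum_addf)
    qed
  qed
qed

lemma monom_mult:
  assumes a: "a \<in> carrier S" and g: "g \<in> laurent_series S"
  shows "series_monom S a i \<otimes>\<^bsub>L\<^esub> g = series_smult S a (P i g)"
proof
  fix k
  obtain n where n: "g \<in> series_from S n" using g by (rule laurent_seriesE)
  have P: "P i g k \<in> carrier S" for i using P_from[OF n] by (simp add: series_from_def)
  have "(series_monom S a i \<otimes>\<^bsub>L\<^esub> g) k =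
      (\<Oplus>j\<in>insert i {i..k - n}. series_monom S a i j \<otimes> P j g k)"
    by (rule mult_coeff[OF series_monom_from[OF a] n]) auto
  also have "\<dots> = (\<Oplus>j\<in>{i}. a \<otimes> P j g k)"
    by (rule add.finprod_mono_neutral_cong_right) (use a P in \<open>auto simp: series_monom_def\<close>)
  finally show "(series_monom S a i \<otimes>\<^bsub>L\<^esub> g) k = series_smult S a (P i g) k"
    using a P by (simp add: series_smult_def)
qed

lemma monom_0_mult:
  "\<lbrakk>a \<in> carrier S; g \<in> laurent_series S\<rbrakk> \<Longrightarrow> series_monom S a 0 \<otimes>\<^bsub>L\<^esub> g = series_smult S a g"
  by (simp add: monom_mult)

lemma smult_monom:
  "\<lbrakk>a \<in> carrier S; b \<in> carrier S\<rbrakk> \<Longrightarrow>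
    series_smult S a (series_monom S b i) = series_monom S (a \<otimes> b) i"
  by (auto simp: series_smult_def series_monom_def)

lemma smult_smult:
  "\<lbrakk>a \<in> carrier S; b \<in> carrier S; g \<in> laurent_series S\<rbrakk> \<Longrightarrow>
    series_smult S a (series_smult S b g) = series_smult S (a \<otimes> b) g"
  by (auto simp: series_smult_def m_assoc series_coeff_closed)

lemma smult_closed [simp]:
  "\<lbrakk>a \<in> carrier S; g \<in> laurent_series S\<rbrakk> \<Longrightarrow> series_smult S a g \<in> laurent_series S"
  using filtered_additive_closed filtered_additive_smult by blast

lemma smult_mult:
  assumes a: "a \<in> carrier S" and g: "g \<in> laurent_series S" and h: "h \<in> laurent_series S"
  shows "series_smult S a g \<otimes>\<^bsub>L\<^esub> h = series_smult S a (g \<otimes>\<^bsub>L\<^esub> h)"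
  by (rule filtered_additive_eqI[OF ring_axioms
        filtered_additive_compose[OF filtered_additive_smult filtered_additive_mult_left]
        filtered_additive_compose[OF filtered_additive_mult_left filtered_additive_smult]])
    (use a g h in \<open>simp_all add: smult_monom monom_mult smult_smult\<close>)

lemma Y_monom:
  assumes "a \<in> carrier S"
  shows "Y (series_monom S a i) =
    series_add S (series_monom S a (i - 1)) (series_monom S (\<ominus> D a) i)"
  using assms by (auto simp: lmult_var_inv_def series_add_def series_monom_def minus_eq)

text \<open>
  The Leibniz rule of \<open>D\<close> in the form \<open>u^-1 a g = a u^-1 g - D(a) g\<close>.
\<close>

lemma Y_smult:
  assumes "a \<in> carrier S" "g \<in> laurent_series S"
  shows "Y (series_smult S a g) =
    series_add S (series_smult S a (Y g)) (series_smult S (\<ominus> D a) g)"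
proof
  fix k
  have [simp]: "g i \<in> carrier S" for i using series_coeff_closed[OF assms(2)] .
  show "Y (series_smult S a g) k =
      series_add S (series_smult S a (Y g)) (series_smult S (\<ominus> D a) g) k"
    using assms(1) by (simp add: lmult_var_inv_def series_add_def series_smult_def minus_eq
        D_mult r_distr minus_add l_minus r_minus a_ac)
qed

text \<open>
  For a monomial \<open>g\<close> this is the preceding Leibniz rule.  It is the only place where
  the relation between \<open>u\<close> and the coefficients is used for associativity.
\<close>

lemma Y_mult:
  assumes g: "g \<in> laurent_series S" and h: "h \<in> laurent_series S"
  shows "Y (g \<otimes>\<^bsub>L\<^esub> h) = Y g \<otimes>\<^bsub>L\<^esub> h"
  by (rule filtered_additive_eqI[OF ring_axioms
        filtered_additive_compose[OF filtered_additive_mult_left filtered_additive_Y]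
        filtered_additive_compose[OF filtered_additive_Y filtered_additive_mult_left]])
    (use g h in \<open>simp_all add: Y_monom monom_mult Y_smult Y_P
        filtered_additive_add[OF filtered_additive_mult_left]\<close>)

lemma X_mult:
  assumes g: "g \<in> laurent_series S" and h: "h \<in> laurent_series S"
  shows "X (g \<otimes>\<^bsub>L\<^esub> h) = X g \<otimes>\<^bsub>L\<^esub> h"
  by (rule X_eqI) (use g h in \<open>simp_all add: Y_mult Y_X\<close>)

lemma P_mult:
  assumes g: "g \<in> laurent_series S" and h: "h \<in> laurent_series S"
  shows "P i (g \<otimes>\<^bsub>L\<^esub> h) = P i g \<otimes>\<^bsub>L\<^esub> h"
  by (rule P_induct[where Q = "\<lambda>i f. f = P i g \<otimes>\<^bsub>L\<^esub> h"])
    (use g h in \<open>simp_all add: X_mult Y_mult X_P Y_P\<close>)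

text \<open>
  For monomials \<open>f = a u^i\<close> the claim says that left multiplication by \<open>a\<close> and by \<open>u^i\<close> commutes
  with right multiplication by \<open>h\<close>, which was shown for \<open>u^-1\<close> and follows for its inverse.
\<close>

lemma mult_assoc:
  assumes f: "f \<in> laurent_series S" and g: "g \<in> laurent_series S" and h: "h \<in> laurent_series S"
  shows "f \<otimes>\<^bsub>L\<^esub> g \<otimes>\<^bsub>L\<^esub> h = f \<otimes>\<^bsub>L\<^esub> (g \<otimes>\<^bsub>L\<^esub> h)"
  by (rule filtered_additive_eqI[OF ring_axioms
        filtered_additive_compose[OF filtered_additive_mult_left filtered_additive_mult_left]
        filtered_additive_mult_left])
    (use f g h in \<open>simp_all add: monom_mult smult_mult P_mult\<close>)

lemma P_one: "P i (series_monom S \<one> 0) = series_monom S \<one> i"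
proof (rule P_induct[where Q = "\<lambda>i f. f = series_monom S \<one> i"])
  have Y: "Y (series_monom S \<one> i) = series_monom S \<one> (i - 1)" for i
    by (simp add: Y_monom) (auto simp: series_add_def series_monom_def)
  show "Y (P i (series_monom S \<one> 0)) = series_monom S \<one> (i - 1)"
    if "P i (series_monom S \<one> 0) = series_monom S \<one> i" for i
    using that Y by simp
  show "X (P i (series_monom S \<one> 0)) = series_monom S \<one> (i + 1)"
    if "P i (series_monom S \<one> 0) = series_monom S \<one> i" for i
    by (rule X_eqI) (use that Y in simp_all)
qed simp_all

lemma mult_one:
  assumes f: "f \<in> laurent_series S"
  shows "f \<otimes>\<^bsub>L\<^esub> series_monom S \<one> 0 = f"
  by (rule filtered_additive_eqI[OF ring_axioms filtered_additive_mult_left filtered_additive_id])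
    (use f in \<open>simp_all add: monom_mult P_one smult_monom\<close>)

lemma smult_one: "f \<in> laurent_series S \<Longrightarrow> series_smult S \<one> f = f"
  by (auto simp: series_smult_def series_coeff_closed)

lemma zero_laurent: "(\<lambda>i. \<zero>) \<in> laurent_series S"
  by (auto simp: laurent_series_def series_from_def)

lemma skew_laurent_ring: "ring L"
proof (rule ringI)
  show "abelian_group L"
  proof (rule abelian_groupI, unfold skew_laurent_simps)
    fix f assume f: "f \<in> laurent_series S"
    then have "series_smult S (\<ominus> \<one>) f \<in> laurent_series S" by simp
    moreover have "series_add S (series_smult S (\<ominus> \<one>) f) f = (\<lambda>i. \<zero>)"
      using f by (auto simp: series_add_def series_smult_def series_coeff_closed l_minus l_neg)
    ultimately show "\<exists>g\<in>laurent_series S. series_add S g f = (\<lambda>i. \<zero>)" by blast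
  next
    fix f g assume "f \<in> laurent_series S" "g \<in> laurent_series S"
    then show "series_add S f g = series_add S g f"
      by (auto simp: series_add_def series_coeff_closed a_comm)
  qed (simp_all add: zero_laurent, auto simp: series_add_def series_coeff_closed a_assoc)
  show "monoid L"
    by (rule monoidI, unfold skew_laurent_simps)
      (simp_all add: mult_assoc mult_one monom_mult smult_one)
qed (simp_all add: skew_laurent_simps filtered_additive_add[OF filtered_additive_mult_left]
    filtered_additive_add[OF filtered_additive_mult_right])

end

section \<open>Integer powers of units\<close>

context monoid
begin

lemma units_of_int_pow:
  assumes "x \<in> Units G" shows "x [^]\<^bsub>units_of G\<^esub> (i::int) = x [^] i"
proof -
  have pow: "x [^]\<^bsub>units_of G\<^esub> (n::nat) = x [^] n" for n
    by (simp add: nat_pow_def units_of_mult units_of_one)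
  have "x [^] (n::nat) \<in> Units G" for n
    by (induction n) (use assms in auto)
  then show ?thesis unfolding int_pow_def2 pow by (simp only: units_of_inv)
qed

lemma Units_int_pow_closed:
  assumes "x \<in> Units G" shows "x [^] (i::int) \<in> Units G"
  using group.int_pow_closed[OF units_group, of x i] assms
  by (simp add: units_of_int_pow units_of_carrier)

lemma Units_int_pow_add:
  assumes "x \<in> Units G" shows "x [^] (i + j::int) = x [^] i \<otimes> x [^] j"
  using group.int_pow_mult[OF units_group, of x i j] assms
  by (simp add: units_of_int_pow units_of_carrier units_of_mult)

lemma Units_int_pow_neg:
  assumes "x \<in> Units G" shows "x [^] (- i::int) = inv x [^] i"
  using group.int_pow_inv[OF units_group, of x i] group.int_pow_neg[OF units_group, of x i] assms
  by (simp add: units_of_int_pow units_of_carrier units_of_inv Units_int_pow_closed)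

lemma Units_int_pow_1: "x \<in> Units G \<Longrightarrow> x [^] (1::int) = x"
  using group.int_pow_1[OF units_group, of x] by (simp add: units_of_int_pow units_of_carrier)

lemma Units_int_pow_pred:
  assumes "x \<in> Units G" shows "x [^] (i - 1::int) = inv x \<otimes> x [^] i"
  using Units_int_pow_add[OF assms, of "-1" i] Units_int_pow_neg[OF assms, of 1] assms
  by (simp add: Units_int_pow_1)

lemma Units_of_inverse:
  assumes "x \<in> carrier G" "y \<in> carrier G" "x \<otimes> y = \<one>" "y \<otimes> x = \<one>"
  shows "x \<in> Units G" "inv x = y"
  using assms inv_unique'[of x y] by (auto simp: Units_def)

end

text \<open>
  A sum of terms \<open>E f n\<close> of order at least \<open>n\<close>, each vanishing with the coefficient \<open>f n\<close>, is
  coefficientwise finite: for \<open>f\<close> of order \<open>m\<close> only \<open>n\<close> in \<open>{m..k}\<close> contribute to the coefficient \<open>k\<close>.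
\<close>

lemma (in ring) filtered_additive_series_sum:
  assumes E: "\<And>f n. f \<in> laurent_series T \<Longrightarrow> E f n \<in> series_from R n"
    and zero: "\<And>f n. \<lbrakk>f \<in> laurent_series T; f n = \<zero>\<^bsub>T\<^esub>\<rbrakk> \<Longrightarrow> E f n = (\<lambda>k. \<zero>)"
    and add: "\<And>f g n. \<lbrakk>f \<in> laurent_series T; g \<in> laurent_series T\<rbrakk> \<Longrightarrow>
      E (series_add T f g) n = series_add R (E f n) (E g n)"
    and T: "ring T"
  shows "\<And>f m. f \<in> series_from T m \<Longrightarrow> series_sum R (E f) \<in> series_from R m"
    and "filtered_additive T R (\<lambda>f. series_sum R (E f))"
    and "\<And>f. f \<in> laurent_series T \<Longrightarrow> series_summable R (E f)"
proof -
  have Ec: "E f n k \<in> carrier R" if "f \<in> laurent_series T" for f n k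
    using E[OF that] by (simp add: series_from_def)
  have out: "E f n k = \<zero>" if "f \<in> series_from T m" "n \<notin> {m..k}" for f m n k
  proof (cases "n < m")
    case True
    then have "f n = \<zero>\<^bsub>T\<^esub>" using that by (simp add: series_from_def)
    then show ?thesis using zero series_from_laurent[OF that(1)] by metis
  next
    case False
    then show ?thesis using that(2) E[OF series_from_laurent[OF that(1)], of n]
      by (simp add: series_from_def)
  qed
  have eq: "series_sum R (E f) k = (\<Oplus>n\<in>{m..k}. E f n k)" if f: "f \<in> series_from T m" for f m k
    unfolding series_sum_def
  proof (rule add.finprod_mono_neutral_cong_left)
    show "{n. E f n k \<noteq> \<zero>} \<subseteq> {m..k}" using out[OF f] by blast
  qed (use Ec[OF series_from_laurent[OF f]] in auto)
  show "series_summable R (E f)" if f: "f \<in> laurent_series T" for f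
  proof -
    obtain m where "f \<in> series_from T m" using f by (rule laurent_seriesE)
    then have "{n. E f n k \<noteq> \<zero>} \<subseteq> {m..k}" for k using out by blast
    then show ?thesis unfolding series_summable_def by (meson finite_atLeastAtMost_int finite_subset)
  qed
  show sum_from: "series_sum R (E f) \<in> series_from R m" if f: "f \<in> series_from T m" for f m
  proof -
    have "series_sum R (E f) k \<in> carrier R" for k
      unfolding eq[OF f] by (intro finsum_closed) (use Ec[OF series_from_laurent[OF f]] in auto)
    moreover have "series_sum R (E f) k = \<zero>" if "k < m" for k
      unfolding eq[OF f] using that by simp
    ultimately show ?thesis by (simp add: series_from_def)
  qed
  show "filtered_additive T R (\<lambda>f. series_sum R (E f))"
  proof (rule filtered_additiveI)
    show "series_sum R (E f) \<in> series_from R (m + 0)" if "f \<in> series_from T m" for f m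
      using sum_from[OF that] by simp
    fix f g assume fg: "f \<in> laurent_series T" "g \<in> laurent_series T"
    obtain m where m: "f \<in> series_from T m" "g \<in> series_from T m"
      using ring.laurent_series_common[OF T fg] .
    show "series_sum R (E (series_add T f g)) = series_add R (series_sum R (E f)) (series_sum R (E g))"
    proof
      fix k
      show "series_sum R (E (series_add T f g)) k =
          series_add R (series_sum R (E f)) (series_sum R (E g)) k"
        using Ec[OF fg(1)] Ec[OF fg(2)]
        unfolding series_add_def[of R "series_sum R (E f)"]
          eq[OF m(1)] eq[OF m(2)] eq[OF ring.series_add_from[OF T m]] add[OF fg]
        by (simp add: series_add_def finsum_addf)
    qed
  qed
qed

section \<open>Homomorphisms determined by their values on coefficients and on the variable\<close>

context skew_coefficients
begin

lemma monom_mult_monom_0: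
  assumes "a \<in> carrier S" "b \<in> carrier S"
  shows "series_monom S a 0 \<otimes>\<^bsub>L\<^esub> series_monom S b i = series_monom S (a \<otimes> b) i"
  using assms by (simp add: monom_mult smult_monom)

lemma var_mult: "g \<in> laurent_series S \<Longrightarrow> series_monom S \<one> i \<otimes>\<^bsub>L\<^esub> g = P i g"
  by (simp add: monom_mult smult_one)

lemma var_mult_var: "series_monom S \<one> i \<otimes>\<^bsub>L\<^esub> series_monom S \<one> j = series_monom S \<one> (i + j)"
proof -
  have "P i (series_monom S \<one> j) = series_monom S \<one> (i + j)"
  proof (rule P_induct[where Q = "\<lambda>i f. f = series_monom S \<one> (i + j)"])
    have Y: "Y (series_monom S \<one> i) = series_monom S \<one> (i - 1)" for i
      by (simp add: Y_monom) (auto simp: series_add_def series_monom_def)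
    show "Y (P i (series_monom S \<one> j)) = series_monom S \<one> (i - 1 + j)"
      if "P i (series_monom S \<one> j) = series_monom S \<one> (i + j)" for i
      using that Y by (simp add: algebra_simps)
    show "X (P i (series_monom S \<one> j)) = series_monom S \<one> (i + 1 + j)"
      if "P i (series_monom S \<one> j) = series_monom S \<one> (i + j)" for i
      by (rule X_eqI) (use that Y in \<open>simp_all add: algebra_simps\<close>)
  qed simp_all
  then show ?thesis by (simp add: var_mult)
qed

lemma monom_eq_mult:
  "a \<in> carrier S \<Longrightarrow> series_monom S a i = series_monom S a 0 \<otimes>\<^bsub>L\<^esub> series_monom S \<one> i"
  by (simp add: monom_mult_monom_0)

text \<open>
  The values on \<open>u^-1\<close> determine those on \<open>u\<close>, because inverses are unique, hence on all
  monomials.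
\<close>

lemma filtered_hom_eqI:
  assumes V: "skew_coefficients V E"
    and F: "F \<in> ring_hom L (skew_laurent V E)" "filtered_additive S V F"
    and G: "G \<in> ring_hom L (skew_laurent V E)" "filtered_additive S V G"
    and const: "\<And>a. a \<in> carrier S \<Longrightarrow> F (series_monom S a 0) = G (series_monom S a 0)"
    and var: "F (series_monom S \<one> (-1)) = G (series_monom S \<one> (-1))"
    and f: "f \<in> laurent_series S"
  shows "F f = G f"
proof -
  let ?T = "skew_laurent V E"
  interpret T: ring ?T by (rule skew_coefficients.skew_laurent_ring[OF V])
  let ?x = "\<lambda>i. series_monom S \<one> i"
  have Fc: "F g \<in> carrier ?T" "G g \<in> carrier ?T" if "g \<in> laurent_series S" for g
    using F(1) G(1) that by (auto simp: ring_hom_def Pi_def skew_laurent_simps)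
  have mult: "H (?x (i + j)) = H (?x i) \<otimes>\<^bsub>?T\<^esub> H (?x j)" "H (?x 0) = \<one>\<^bsub>?T\<^esub>"
    if "H \<in> ring_hom L ?T" for H i j
    using that ring_hom_mult[OF that, of "?x i" "?x j"] ring_hom_one[OF that]
    by (simp_all add: skew_laurent_simps var_mult_var)
  have var1: "F (?x 1) = G (?x 1)"
  proof (rule T.inv_unique)
    show "F (?x 1) \<otimes>\<^bsub>?T\<^esub> F (?x (-1)) = \<one>\<^bsub>?T\<^esub>"
      using mult(1)[OF F(1), of 1 "-1"] mult(2)[OF F(1)] by simp
    show "F (?x (-1)) \<otimes>\<^bsub>?T\<^esub> G (?x 1) = \<one>\<^bsub>?T\<^esub>"
      using mult(1)[OF G(1), of "-1" 1] mult(2)[OF G(1)] var by simp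
  qed (simp_all add: Fc)
  have "F (?x i) = G (?x i)" for i
  proof (induction i rule: int_induct[where k = 0])
    case base
    then show ?case by (simp add: mult(2)[OF F(1)] mult(2)[OF G(1)])
  next
    case (step1 i)
    then show ?case using mult(1)[OF F(1), of i 1] mult(1)[OF G(1), of i 1] var1 by simp
  next
    case (step2 i)
    then show ?case using mult(1)[OF F(1), of i "-1"] mult(1)[OF G(1), of i "-1"] var by simp
  qed
  then have "F (series_monom S a i) = G (series_monom S a i)" if "a \<in> carrier S" for a i
    using that const[OF that] ring_hom_mult[OF F(1)] ring_hom_mult[OF G(1)]
    by (subst (1 2) monom_eq_mult) (simp_all add: skew_laurent_simps)
  then show ?thesis
    by (rule filtered_additive_eqI[OF ring_axioms F(2) G(2) _ f])
qed

end

section \<open>Substitution of a unit for the variable\<close>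

text \<open>
  The bounds on \<open>w\<close> and \<open>w^-1\<close> give \<open>w^i\<close> the order at least \<open>i\<close> for every integer \<open>i\<close>, so that
  the sum of the \<open>\<phi>(f i) w^i\<close> is coefficientwise finite.  The last condition is the image under
  \<open>u \<mapsto> w\<close> of the relation that defines the ring of series in \<open>u\<close>.
\<close>

locale skew_substitution =
  S: skew_coefficients S D + T: skew_coefficients T E
  for S :: "('a, 'm) ring_scheme" and D and T :: "('b, 'n) ring_scheme" and E +
  fixes \<phi> :: "'a \<Rightarrow> 'b" and w :: "int \<Rightarrow> 'b"
  assumes hom: "\<phi> \<in> ring_hom S T"
    and w_unit: "w \<in> Units (skew_laurent T E)"
    and w_from: "w \<in> series_from T 1"
    and w_inv_from: "inv\<^bsub>skew_laurent T E\<^esub> w \<in> series_from T (-1)"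
    and commutation: "a \<in> carrier S \<Longrightarrow>
      inv\<^bsub>skew_laurent T E\<^esub> w \<otimes>\<^bsub>skew_laurent T E\<^esub> series_monom T (\<phi> a) 0 =
        series_monom T (\<phi> a) 0 \<otimes>\<^bsub>skew_laurent T E\<^esub> inv\<^bsub>skew_laurent T E\<^esub> w
          \<oplus>\<^bsub>skew_laurent T E\<^esub> series_monom T (\<ominus>\<^bsub>T\<^esub> \<phi> (D a)) 0"
begin

abbreviation B where "B \<equiv> skew_laurent T E"

definition subst_term :: "(int \<Rightarrow> 'a) \<Rightarrow> int \<Rightarrow> int \<Rightarrow> 'b" where
  "subst_term f n = series_monom T (\<phi> (f n)) 0 \<otimes>\<^bsub>B\<^esub> (w [^]\<^bsub>B\<^esub> n)"

definition subst :: "(int \<Rightarrow> 'a) \<Rightarrow> int \<Rightarrow> 'b" where "subst f = series_sum T (subst_term f)"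

sublocale B: ring B by (rule T.skew_laurent_ring)

lemma \<phi>_simps:
  "a \<in> carrier S \<Longrightarrow> \<phi> a \<in> carrier T"
  "\<lbrakk>a \<in> carrier S; b \<in> carrier S\<rbrakk> \<Longrightarrow> \<phi> (a \<oplus>\<^bsub>S\<^esub> b) = \<phi> a \<oplus>\<^bsub>T\<^esub> \<phi> b"
  "\<lbrakk>a \<in> carrier S; b \<in> carrier S\<rbrakk> \<Longrightarrow> \<phi> (a \<otimes>\<^bsub>S\<^esub> b) = \<phi> a \<otimes>\<^bsub>T\<^esub> \<phi> b"
  "a \<in> carrier S \<Longrightarrow> \<phi> (\<ominus>\<^bsub>S\<^esub> a) = \<ominus>\<^bsub>T\<^esub> \<phi> a"
  "\<phi> \<zero>\<^bsub>S\<^esub> = \<zero>\<^bsub>T\<^esub>" "\<phi> \<one>\<^bsub>S\<^esub> = \<one>\<^bsub>T\<^esub>"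
proof -
  interpret \<phi>: ring_hom_ring S T \<phi>
    by (intro ring_hom_ringI2 S.ring_axioms T.ring_axioms hom)
  show "a \<in> carrier S \<Longrightarrow> \<phi> a \<in> carrier T"
    "\<lbrakk>a \<in> carrier S; b \<in> carrier S\<rbrakk> \<Longrightarrow> \<phi> (a \<oplus>\<^bsub>S\<^esub> b) = \<phi> a \<oplus>\<^bsub>T\<^esub> \<phi> b"
    "\<lbrakk>a \<in> carrier S; b \<in> carrier S\<rbrakk> \<Longrightarrow> \<phi> (a \<otimes>\<^bsub>S\<^esub> b) = \<phi> a \<otimes>\<^bsub>T\<^esub> \<phi> b"
    "a \<in> carrier S \<Longrightarrow> \<phi> (\<ominus>\<^bsub>S\<^esub> a) = \<ominus>\<^bsub>T\<^esub> \<phi> a"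
    "\<phi> \<zero>\<^bsub>S\<^esub> = \<zero>\<^bsub>T\<^esub>" "\<phi> \<one>\<^bsub>S\<^esub> = \<one>\<^bsub>T\<^esub>"
    by simp_all
qed

(* For the identity the closure rule has its own conclusion as a premise; hence the local scope. *)
context
  notes \<phi>_simps [simp]
begin

lemma w_pow_from: "w [^]\<^bsub>B\<^esub> (i::int) \<in> series_from T i"
proof (induction i rule: int_induct[where k = 0])
  case base
  then show ?case by (simp add: skew_laurent_simps T.series_monom_from)
next
  case (step1 i)
  then show ?case
    using T.mult_from[OF _ w_from, of "w [^]\<^bsub>B\<^esub> i" i]
    by (simp add: B.Units_int_pow_add[OF w_unit] B.Units_int_pow_1[OF w_unit])
next
  case (step2 i)
  then show ?case
    using T.mult_from[OF w_inv_from, of "w [^]\<^bsub>B\<^esub> i" i]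
    by (simp add: B.Units_int_pow_pred[OF w_unit])
qed

lemma w_pow_laurent [simp]: "w [^]\<^bsub>B\<^esub> (i::int) \<in> laurent_series T"
  using w_pow_from series_from_laurent by blast

lemma inv_w_laurent [simp]: "inv\<^bsub>B\<^esub> w \<in> laurent_series T"
  using w_inv_from series_from_laurent by blast

lemma subst_term_eq:
  "f \<in> laurent_series S \<Longrightarrow> subst_term f n = series_smult T (\<phi> (f n)) (w [^]\<^bsub>B\<^esub> n)"
  unfolding subst_term_def by (simp add: T.monom_0_mult series_coeff_closed)

lemma subst_from: "f \<in> series_from S m \<Longrightarrow> subst f \<in> series_from T m"
  and subst_filtered_additive: "filtered_additive S T subst"
  and subst_summable: "f \<in> laurent_series S \<Longrightarrow> series_summable T (subst_term f)"
proof -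
  have 1: "subst_term f n \<in> series_from T n" if "f \<in> laurent_series S" for f n
    unfolding subst_term_eq[OF that]
    using w_pow_from[of n] that by (auto simp: series_from_def series_smult_def series_coeff_closed)
  have wc: "(w [^]\<^bsub>B\<^esub> n) k \<in> carrier T" for n k :: int
    by (rule series_coeff_closed[OF w_pow_laurent])
  have 2: "subst_term f n = (\<lambda>k. \<zero>\<^bsub>T\<^esub>)" if "f \<in> laurent_series S" "f n = \<zero>\<^bsub>S\<^esub>" for f n
    unfolding subst_term_eq[OF that(1)] that(2) series_smult_def by (simp add: wc)
  have 3: "subst_term (series_add S f g) n = series_add T (subst_term f n) (subst_term g n)"
    if "f \<in> laurent_series S" "g \<in> laurent_series S" for f g n
    using that series_coeff_closed[OF that(1)] series_coeff_closed[OF that(2)]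
    by (simp add: subst_term_eq) (simp add: series_smult_def series_add_def T.l_distr wc)
  note sum = T.filtered_additive_series_sum[OF 1 2 3 S.ring_axioms]
  show "f \<in> series_from S m \<Longrightarrow> subst f \<in> series_from T m"
    unfolding subst_def by (rule sum(1))
  show "filtered_additive S T subst"
    unfolding subst_def by (rule sum(2))
  show "f \<in> laurent_series S \<Longrightarrow> series_summable T (subst_term f)"
    by (rule sum(3))
qed

lemma subst_monom:
  assumes "a \<in> carrier S"
  shows "subst (series_monom S a i) = series_smult T (\<phi> a) (w [^]\<^bsub>B\<^esub> i)"
proof
  fix k
  have [simp]: "(w [^]\<^bsub>B\<^esub> n) k \<in> carrier T" for n :: int
    by (rule series_coeff_closed[OF w_pow_laurent])
  have t: "subst_term (series_monom S a i) n k = (if n = i then \<phi> a \<otimes>\<^bsub>T\<^esub> (w [^]\<^bsub>B\<^esub> i) k else \<zero>\<^bsub>T\<^esub>)"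
    for n
    using assms by (simp add: subst_term_eq series_smult_def) (simp add: series_monom_def)
  have "subst (series_monom S a i) k = (\<Oplus>\<^bsub>T\<^esub>n\<in>{i}. subst_term (series_monom S a i) n k)"
    unfolding subst_def series_sum_def
    by (rule T.add.finprod_mono_neutral_cong_left) (use assms in \<open>auto simp: t split: if_splits\<close>)
  then show "subst (series_monom S a i) k = series_smult T (\<phi> a) (w [^]\<^bsub>B\<^esub> i) k"
    using assms by (simp add: t series_smult_def)
qed

lemma subst_closed [simp]: "f \<in> laurent_series S \<Longrightarrow> subst f \<in> laurent_series T"
  by (rule filtered_additive_closed[OF subst_filtered_additive])

lemma subst_const: "a \<in> carrier S \<Longrightarrow> subst (series_monom S a 0) = series_monom T (\<phi> a) 0"
  by (simp add: subst_monom skew_laurent_simps T.smult_monom)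

lemma subst_var_pow: "subst (series_monom S \<one>\<^bsub>S\<^esub> i) = w [^]\<^bsub>B\<^esub> i"
  by (simp add: subst_monom T.smult_one)

lemma subst_scaled_var:
  assumes "inv\<^bsub>B\<^esub> w = series_monom T v (-1)" "v \<in> carrier T" "a \<in> carrier S"
  shows "subst (series_monom S a (-1)) = series_monom T (\<phi> a \<otimes>\<^bsub>T\<^esub> v) (-1)"
proof -
  have "w [^]\<^bsub>B\<^esub> (-1::int) = series_monom T v (-1)"
    using B.Units_int_pow_neg[OF w_unit, of 1] B.Units_int_pow_1[OF B.Units_inv_Units[OF w_unit]]
    by (simp add: assms(1))
  then show ?thesis using assms(2,3) by (simp add: subst_monom T.smult_monom)
qed

text \<open>
  On monomials this is exactly the assumed commutation rule between \<open>w^-1\<close> and \<open>\<phi>(a)\<close>.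
\<close>

lemma subst_Y:
  assumes f: "f \<in> laurent_series S"
  shows "subst (S.Y f) = inv\<^bsub>B\<^esub> w \<otimes>\<^bsub>B\<^esub> subst f"
proof (rule filtered_additive_eqI[OF S.ring_axioms
      filtered_additive_compose[OF S.filtered_additive_Y subst_filtered_additive]
      filtered_additive_compose[OF subst_filtered_additive
        T.filtered_additive_mult_right[OF inv_w_laurent]] _ f])
  fix a i assume a: "a \<in> carrier S"
  let ?c = "\<lambda>b. series_monom T b 0"
  have "subst (S.Y (series_monom S a i)) =
      series_add T (series_smult T (\<phi> a) (w [^]\<^bsub>B\<^esub> (i - 1)))
        (series_smult T (\<ominus>\<^bsub>T\<^esub> \<phi> (D a)) (w [^]\<^bsub>B\<^esub> i))"
    using a by (simp add: S.Y_monom filtered_additive_add[OF subst_filtered_additive] subst_monom)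
  also have "\<dots> = ?c (\<phi> a) \<otimes>\<^bsub>B\<^esub> (inv\<^bsub>B\<^esub> w \<otimes>\<^bsub>B\<^esub> w [^]\<^bsub>B\<^esub> i) \<oplus>\<^bsub>B\<^esub>
      ?c (\<ominus>\<^bsub>T\<^esub> \<phi> (D a)) \<otimes>\<^bsub>B\<^esub> w [^]\<^bsub>B\<^esub> i"
    using a by (simp add: T.monom_0_mult B.Units_int_pow_pred[OF w_unit] skew_laurent_simps)
  also have "\<dots> = (?c (\<phi> a) \<otimes>\<^bsub>B\<^esub> inv\<^bsub>B\<^esub> w \<oplus>\<^bsub>B\<^esub> ?c (\<ominus>\<^bsub>T\<^esub> \<phi> (D a))) \<otimes>\<^bsub>B\<^esub> w [^]\<^bsub>B\<^esub> i"
    using a by (subst B.l_distr) (simp_all add: skew_laurent_simps T.mult_assoc)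
  also have "\<dots> = inv\<^bsub>B\<^esub> w \<otimes>\<^bsub>B\<^esub> ?c (\<phi> a) \<otimes>\<^bsub>B\<^esub> w [^]\<^bsub>B\<^esub> i"
    using commutation[OF a] by simp
  also have "\<dots> = inv\<^bsub>B\<^esub> w \<otimes>\<^bsub>B\<^esub> subst (series_monom S a i)"
    using a by (simp add: subst_monom T.monom_0_mult T.mult_assoc)
  finally show "subst (S.Y (series_monom S a i)) = inv\<^bsub>B\<^esub> w \<otimes>\<^bsub>B\<^esub> subst (series_monom S a i)" .
qed

lemma subst_P:
  assumes f: "f \<in> laurent_series S"
  shows "subst (S.P i f) = w [^]\<^bsub>B\<^esub> i \<otimes>\<^bsub>B\<^esub> subst f"
proof (rule S.P_induct[where Q = "\<lambda>i g. subst g = w [^]\<^bsub>B\<^esub> i \<otimes>\<^bsub>B\<^esub> subst f"])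
  show "subst f = w [^]\<^bsub>B\<^esub> (0::int) \<otimes>\<^bsub>B\<^esub> subst f"
    using f B.l_one[of "subst f"] by (simp add: skew_laurent_simps)
  have inv: "inv\<^bsub>B\<^esub> w \<otimes>\<^bsub>B\<^esub> (w [^]\<^bsub>B\<^esub> i \<otimes>\<^bsub>B\<^esub> g) = w [^]\<^bsub>B\<^esub> (i - 1) \<otimes>\<^bsub>B\<^esub> g"
    if "g \<in> laurent_series T" for g and i :: int
    using that by (simp add: B.Units_int_pow_pred[OF w_unit] T.mult_assoc)
  show "subst (S.Y (S.P i f)) = w [^]\<^bsub>B\<^esub> (i - 1) \<otimes>\<^bsub>B\<^esub> subst f"
    if "subst (S.P i f) = w [^]\<^bsub>B\<^esub> i \<otimes>\<^bsub>B\<^esub> subst f" for i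
    using that f by (simp add: subst_Y inv)
  show "subst (S.X (S.P i f)) = w [^]\<^bsub>B\<^esub> (i + 1) \<otimes>\<^bsub>B\<^esub> subst f"
    if IH: "subst (S.P i f) = w [^]\<^bsub>B\<^esub> i \<otimes>\<^bsub>B\<^esub> subst f" for i
  proof -
    have "inv\<^bsub>B\<^esub> w \<otimes>\<^bsub>B\<^esub> subst (S.X (S.P i f)) = subst (S.P i f)"
      using f by (simp add: subst_Y[symmetric] S.Y_X)
    also have "\<dots> = inv\<^bsub>B\<^esub> w \<otimes>\<^bsub>B\<^esub> (w [^]\<^bsub>B\<^esub> (i + 1) \<otimes>\<^bsub>B\<^esub> subst f)"
      using f IH by (simp add: inv)
    finally show ?thesis
      using f B.Units_l_cancel[OF B.Units_inv_Units[OF w_unit]] by (simp add: skew_laurent_simps)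
  qed
qed (rule f)

lemma subst_smult:
  assumes a: "a \<in> carrier S" and f: "f \<in> laurent_series S"
  shows "subst (series_smult S a f) = series_smult T (\<phi> a) (subst f)"
  by (rule filtered_additive_eqI[OF S.ring_axioms
        filtered_additive_compose[OF S.filtered_additive_smult subst_filtered_additive]
        filtered_additive_compose[OF subst_filtered_additive T.filtered_additive_smult]])
    (use a f in \<open>simp_all add: S.smult_monom subst_monom T.smult_smult\<close>)

text \<open>
  For a monomial \<open>f = a u^i\<close> the product is \<open>a (u^i g)\<close>, and substitution turns left
  multiplication by \<open>u^i\<close> into left multiplication by \<open>w^i\<close>.
\<close>

lemma subst_mult:
  assumes f: "f \<in> laurent_series S" and g: "g \<in> laurent_series S"
  shows "subst (f \<otimes>\<^bsub>S.L\<^esub> g) = subst f \<otimes>\<^bsub>B\<^esub> subst g"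
  by (rule filtered_additive_eqI[OF S.ring_axioms
        filtered_additive_compose[OF S.filtered_additive_mult_left subst_filtered_additive]
        filtered_additive_compose[OF subst_filtered_additive T.filtered_additive_mult_left]])
    (use f g in \<open>simp_all add: S.monom_mult subst_smult subst_P subst_monom T.smult_mult\<close>)

lemma subst_hom: "subst \<in> ring_hom S.L B"
  by (rule ring_hom_memI)
    (simp_all add: skew_laurent_simps subst_mult subst_const
      filtered_additive_add[OF subst_filtered_additive])

end

end

context skew_coefficients
begin

lemma scaled_var_inverse:
  assumes v: "v \<in> Units S"
  shows "series_monom S v (-1) \<in> Units L"
    and "inv\<^bsub>L\<^esub> series_monom S v (-1) = series_monom S \<one> 1 \<otimes>\<^bsub>L\<^esub> series_monom S (inv v) 0"
    and "series_monom S v (-1) \<in> series_from S (-1)"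
    and "inv\<^bsub>L\<^esub> series_monom S v (-1) \<in> series_from S 1"
proof -
  interpret L: ring L by (rule skew_laurent_ring)
  have [simp]: "v \<in> carrier S" "inv v \<in> carrier S" using v by auto
  let ?y = "series_monom S v (-1)" and ?x = "series_monom S \<one> 1" and ?c = "series_monom S (inv v) 0"
  have "?y \<otimes>\<^bsub>L\<^esub> (?x \<otimes>\<^bsub>L\<^esub> ?c) = series_monom S v 0 \<otimes>\<^bsub>L\<^esub> (series_monom S \<one> (-1) \<otimes>\<^bsub>L\<^esub> ?x \<otimes>\<^bsub>L\<^esub> ?c)"
    by (simp add: monom_eq_mult[of v "-1"] mult_assoc)
  also have "\<dots> = \<one>\<^bsub>L\<^esub>"
    using v by (simp add: var_mult_var) (simp add: skew_laurent_simps monom_mult_monom_0 )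
  finally have 1: "?y \<otimes>\<^bsub>L\<^esub> (?x \<otimes>\<^bsub>L\<^esub> ?c) = \<one>\<^bsub>L\<^esub>" .
  have "?x \<otimes>\<^bsub>L\<^esub> ?c \<otimes>\<^bsub>L\<^esub> ?y = ?x \<otimes>\<^bsub>L\<^esub> (?c \<otimes>\<^bsub>L\<^esub> ?y)" by (simp add: mult_assoc)
  also have "\<dots> = \<one>\<^bsub>L\<^esub>"
    using v by (simp add: monom_mult_monom_0 var_mult_var) (simp add: skew_laurent_simps)
  finally have 2: "?x \<otimes>\<^bsub>L\<^esub> ?c \<otimes>\<^bsub>L\<^esub> ?y = \<one>\<^bsub>L\<^esub>" .
  note inv = L.Units_of_inverse[OF _ _ 1 2]
  show "?y \<in> Units L" "inv\<^bsub>L\<^esub> ?y = ?x \<otimes>\<^bsub>L\<^esub> ?c"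
    using inv by (simp_all add: skew_laurent_simps)
  then show "inv\<^bsub>L\<^esub> ?y \<in> series_from S 1"
    using mult_from[OF series_monom_from series_monom_from, of \<one> "inv v" 1 0] by simp
  show "?y \<in> series_from S (-1)" by (simp add: series_monom_from)
qed

text \<open>
  Multiplying \<open>u^-1 b = b u^-1 - D(b)\<close> by \<open>v\<close> scales the derivation by \<open>v\<close>.
\<close>

lemma scaled_var_inverse_commute:
  assumes "v \<in> carrier S" "b \<in> carrier S" "v \<otimes> b = b \<otimes> v" "v \<otimes> D b = c"
  shows "series_monom S v (-1) \<otimes>\<^bsub>L\<^esub> series_monom S b 0 =
    series_monom S b 0 \<otimes>\<^bsub>L\<^esub> series_monom S v (-1) \<oplus>\<^bsub>L\<^esub> series_monom S (\<ominus> c) 0"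
proof -
  have "P (-1) (series_monom S b 0) = Y (series_monom S b 0)"
    using assms(2) Y_P[of "series_monom S b 0" 0] by simp
  then show ?thesis
    using assms by (auto simp: monom_mult Y_monom smult_monom skew_laurent_simps)
      (auto simp: series_smult_def series_add_def series_monom_def r_minus)
qed

end

text \<open>
  All substitutions below send \<open>u^-1\<close> to \<open>v x^-1\<close> for a unit \<open>v\<close>; the commutation rule then becomes an
  identity between the two derivations.
\<close>

lemma skew_substitutionI:
  assumes "skew_coefficients S D" "skew_coefficients T E" "cring T" "\<phi> \<in> ring_hom S T"
    and v: "v \<in> Units T"
    and D: "\<And>a. a \<in> carrier S \<Longrightarrow> v \<otimes>\<^bsub>T\<^esub> E (\<phi> a) = \<phi> (D a)"
  shows "skew_substitution S D T E \<phi> (inv\<^bsub>skew_laurent T E\<^esub> series_monom T v (-1))"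
proof -
  interpret S: skew_coefficients S D by fact
  interpret T: skew_coefficients T E by fact
  interpret T': cring T by fact
  interpret B: ring "skew_laurent T E" by (rule T.skew_laurent_ring)
  note y = T.scaled_var_inverse[OF v]
  have inv: "inv\<^bsub>skew_laurent T E\<^esub> (inv\<^bsub>skew_laurent T E\<^esub> series_monom T v (-1)) =
      series_monom T v (-1)"
    using y(1) by simp
  have [simp]: "\<phi> a \<in> carrier T" if "a \<in> carrier S" for a
    using that assms(4) by (auto simp: ring_hom_def Pi_def)
  show ?thesis
  proof unfold_locales
    fix a assume a: "a \<in> carrier S"
    show "inv\<^bsub>T.L\<^esub> (inv\<^bsub>T.L\<^esub> series_monom T v (- 1)) \<otimes>\<^bsub>T.L\<^esub> series_monom T (\<phi> a) 0 =
        series_monom T (\<phi> a) 0 \<otimes>\<^bsub>T.L\<^esub> inv\<^bsub>T.L\<^esub> (inv\<^bsub>T.L\<^esub> series_monom T v (- 1)) \<oplus>\<^bsub>T.L\<^esub>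
          series_monom T (\<ominus>\<^bsub>T\<^esub> \<phi> (D a)) 0"
      unfolding inv
      by (rule T.scaled_var_inverse_commute) (use a v D in \<open>auto intro: T'.m_comm\<close>)
  qed (use y(3,4) B.Units_inv_Units[OF y(1)] assms(4) inv in simp_all)
qed

section \<open>Functions up to countable sets\<close>

lemma fun_eq_refl [simp]: "fun_eq U f f"
  by (simp add: fun_eq_def)

lemma fun_eq_sym: "fun_eq U f g \<Longrightarrow> fun_eq U g f"
  by (simp add: fun_eq_def eq_commute)

lemma fun_eq_subset:
  assumes "countable C" "\<And>z. \<lbrakk>z \<in> U; z \<notin> C\<rbrakk> \<Longrightarrow> f z = g z"
  shows "fun_eq U f g"
  unfolding fun_eq_def by (rule countable_subset[OF _ assms(1)]) (use assms(2) in blast)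

lemma fun_eq_trans [trans]:
  assumes "fun_eq U f g" "fun_eq U g h" shows "fun_eq U f h"
  by (rule fun_eq_subset[where C = "{z \<in> U. f z \<noteq> g z} \<union> {z \<in> U. g z \<noteq> h z}"])
    (use assms in \<open>auto simp: fun_eq_def\<close>)

lemma fun_eq_op:
  assumes "fun_eq U f f'" "fun_eq U g g'"
  shows "fun_eq U (\<lambda>z. op (f z) (g z)) (\<lambda>z. op (f' z) (g' z))"
  by (rule fun_eq_subset[where C = "{z \<in> U. f z \<noteq> f' z} \<union> {z \<in> U. g z \<noteq> g' z}"])
    (use assms in \<open>auto simp: fun_eq_def\<close>)

text \<open>
  The complement of a countable set accumulates at every point of an open set, so the derivative
  can be computed as a limit along this complement.
\<close>

lemma derivative_unique_off_countable:
  assumes U: "open U" "z \<in> U" and C: "countable C"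
    and eq: "\<And>w. \<lbrakk>w \<in> U; w \<notin> C\<rbrakk> \<Longrightarrow> f w = g w" and z: "z \<notin> C"
    and f: "(f has_field_derivative a) (at z)" and g: "(g has_field_derivative b) (at z)"
  shows "a = (b :: complex)"
proof (rule tendsto_unique)
  let ?F = "at z within (U - C)"
  show "?F \<noteq> bot"
  proof -
    have "z islimpt (U - C)"
      unfolding islimpt_approachable
    proof (intro allI impI)
      fix e :: real assume "0 < e"
      obtain d where d: "0 < d" "ball z d \<subseteq> U" using U open_contains_ball by blast
      have "uncountable (ball z (min d e))"
        using d(1) \<open>0 < e\<close> by (intro uncountable_ball) simp
      then have "uncountable (ball z (min d e) - (insert z C))"
        using C by (simp add: uncountable_minus_countable)
      then obtain w where "w \<in> ball z (min d e) - insert z C"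
        by (metis all_not_in_conv countable_empty)
      then show "\<exists>w\<in>U - C. w \<noteq> z \<and> dist w z < e"
        using d(2) by (auto simp: dist_commute subset_iff)
    qed
    then show ?thesis by (simp add: trivial_limit_within)
  qed
  have "((\<lambda>w. (f w - f z) / (w - z)) \<longlongrightarrow> a) ?F"
    using has_field_derivative_at_within[OF f] by (simp add: has_field_derivative_iff)
  moreover have "\<forall>\<^sub>F w in ?F. (f w - f z) / (w - z) = (g w - g z) / (w - z)"
    using eq z U(2) by (auto simp: eventually_at_filter)
  ultimately show "((\<lambda>w. (g w - g z) / (w - z)) \<longlongrightarrow> a) ?F"
    by (rule Lim_transform_eventually)
  show "((\<lambda>w. (g w - g z) / (w - z)) \<longlongrightarrow> b) ?F"
    using has_field_derivative_at_within[OF g] by (simp add: has_field_derivative_iff)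
qed

text \<open>
  Functions that are equal off a countable set need not be equal near any point, so that
  their derivatives agree does not follow from the locality of derivatives.
\<close>

lemma is_derivative_unique:
  assumes U: "open U" and f: "is_derivative U f f'" and g: "is_derivative U g g'"
    and eq: "fun_eq U f g"
  shows "fun_eq U f' g'"
proof -
  let ?C = "{z \<in> U. f z \<noteq> g z}"
  let ?A = "{z \<in> U. \<not> (f has_field_derivative f' z) (at z)}"
  let ?B = "{z \<in> U. \<not> (g has_field_derivative g' z) (at z)}"
  show ?thesis
  proof (rule fun_eq_subset[where C = "?A \<union> ?B \<union> ?C"])
    show "countable (?A \<union> ?B \<union> ?C)"
      using f g eq by (simp add: is_derivative_def fun_eq_def)
    show "f' z = g' z" if "z \<in> U" "z \<notin> ?A \<union> ?B \<union> ?C" for z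
      by (rule derivative_unique_off_countable[OF U that(1), of ?C f g])
        (use that eq in \<open>auto simp: fun_eq_def\<close>)
  qed
qed

section \<open>Homographies\<close>

lemma countable_denom_zero:
  assumes "det \<gamma> = 1" shows "countable {z. denom \<gamma> z = 0}"
proof (rule countable_subset)
  show "{z. denom \<gamma> z = 0} \<subseteq> {- \<gamma> $ 2 $ 2 / \<gamma> $ 2 $ 1}"
  proof
    fix z assume "z \<in> {z. denom \<gamma> z = 0}"
    then have z: "\<gamma> $ 2 $ 1 * z = - \<gamma> $ 2 $ 2" by (simp add: denom_def add_eq_0_iff)
    with assms have "\<gamma> $ 2 $ 1 \<noteq> 0" by (auto simp: det_2)
    then show "z \<in> {- \<gamma> $ 2 $ 2 / \<gamma> $ 2 $ 1}" using z by (simp add: field_simps)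
  qed
qed simp

lemma homography_inj:
  assumes "det \<gamma> = 1" "denom \<gamma> z \<noteq> 0" "denom \<gamma> w \<noteq> 0" "homography \<gamma> z = homography \<gamma> w"
  shows "z = w"
proof -
  have "(\<gamma> $ 1 $ 1 * z + \<gamma> $ 1 $ 2) * denom \<gamma> w = (\<gamma> $ 1 $ 1 * w + \<gamma> $ 1 $ 2) * denom \<gamma> z"
    using assms by (simp add: homography_def frac_eq_eq)
  then have "(\<gamma> $ 1 $ 1 * \<gamma> $ 2 $ 2 - \<gamma> $ 1 $ 2 * \<gamma> $ 2 $ 1) * (z - w) = 0"
    by (simp add: denom_def algebra_simps)
  then show ?thesis using assms(1) by (auto simp: det_2)
qed

text \<open>
  A homography is injective away from its pole.
\<close>

lemma countable_homography_preimage: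
  assumes "det \<gamma> = 1" "countable C"
  shows "countable {z. homography \<gamma> z \<in> C}"
proof -
  let ?A = "{z. denom \<gamma> z \<noteq> 0 \<and> homography \<gamma> z \<in> C}"
  have "inj_on (homography \<gamma>) ?A" using homography_inj[OF assms(1)] by (auto intro!: inj_onI)
  moreover have "countable (homography \<gamma> ` ?A)"
    by (rule countable_subset[OF _ assms(2)]) auto
  ultimately have "countable ?A" by (rule countable_image_inj_on[rotated])
  then have "countable (?A \<union> {z. denom \<gamma> z = 0})"
    using countable_denom_zero[OF assms(1)] by simp
  then show ?thesis by (rule countable_subset[rotated]) auto
qed

lemma homography_has_derivative:
  assumes "det \<gamma> = 1" "denom \<gamma> z \<noteq> 0"
  shows "(homography \<gamma> has_field_derivative 1 / (denom \<gamma> z)\<^sup>2) (at z)"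
proof -
  have d: "(denom \<gamma> has_field_derivative \<gamma> $ 2 $ 1) (at z)"
    unfolding denom_def by (auto intro!: derivative_eq_intros)
  have n: "((\<lambda>z. \<gamma> $ 1 $ 1 * z + \<gamma> $ 1 $ 2) has_field_derivative \<gamma> $ 1 $ 1) (at z)"
    by (auto intro!: derivative_eq_intros)
  have "\<gamma> $ 1 $ 1 * denom \<gamma> z - (\<gamma> $ 1 $ 1 * z + \<gamma> $ 1 $ 2) * \<gamma> $ 2 $ 1 = det \<gamma>"
    by (simp add: denom_def det_2 algebra_simps)
  then show ?thesis
    using DERIV_divide[OF n d assms(2)] assms(1) unfolding homography_def[abs_def]
    by (simp add: power2_eq_square)
qed

section \<open>The derivation and the action on the algebra of functions\<close>

context modular_function_algebra
begin

sublocale domain R by (rule domain_R)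

lemma det_\<Gamma>: "\<gamma> \<in> \<Gamma> \<Longrightarrow> det \<gamma> = 1"
  using subgroup.subset[OF subgroup_\<Gamma>] by (auto simp: SL2_def)

lemma fun_eq_homography:
  assumes "\<gamma> \<in> \<Gamma>" "fun_eq U f g"
  shows "fun_eq U (\<lambda>z. f (homography \<gamma> z)) (\<lambda>z. g (homography \<gamma> z))"
proof (rule fun_eq_subset)
  have "countable {w \<in> U. f w \<noteq> g w}" using assms(2) by (simp add: fun_eq_def)
  from countable_homography_preimage[OF det_\<Gamma>[OF assms(1)] this]
  show "countable ({z \<in> U. homography \<gamma> z \<notin> U} \<union>
      {z. homography \<gamma> z \<in> {w \<in> U. f w \<noteq> g w}})"
    using moebius_U[OF assms(1)] by (rule countable_Un[rotated])
qed blast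

lemma elem_of_props:
  assumes "\<exists>g\<in>carrier R. fun_eq U g h"
  shows "elem_of U R h \<in> carrier R" "fun_eq U (elem_of U R h) h"
proof -
  have "\<exists>!g. g \<in> carrier R \<and> fun_eq U g h"
    using assms fun_eqD by (meson fun_eq_sym fun_eq_trans)
  from theI'[OF this] show "elem_of U R h \<in> carrier R" "fun_eq U (elem_of U R h) h"
    by (auto simp: elem_of_def)
qed

lemma elem_of_eq: "\<lbrakk>g \<in> carrier R; fun_eq U g h\<rbrakk> \<Longrightarrow> elem_of U R h = g"
  using elem_of_props[of h] fun_eqD by (meson fun_eq_sym fun_eq_trans)

lemma act_props:
  assumes "f \<in> carrier R" "\<gamma> \<in> \<Gamma>"
  shows "act U R \<gamma> f \<in> carrier R" "fun_eq U (act U R \<gamma> f) (\<lambda>z. f (homography \<gamma> z))"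
  using elem_of_props[OF act_mem[OF assms]] by (auto simp: act_def)

lemma act_eqI:
  "\<lbrakk>g \<in> carrier R; fun_eq U g (\<lambda>z. f (homography \<gamma> z))\<rbrakk> \<Longrightarrow> act U R \<gamma> f = g"
  unfolding act_def by (rule elem_of_eq)

lemma dz_props:
  assumes "f \<in> carrier R"
  shows "dz U R f \<in> carrier R" "is_derivative U f (dz U R f)"
proof -
  have "\<exists>!g. g \<in> carrier R \<and> is_derivative U f g"
    using dz_mem[OF assms] is_derivative_unique[OF open_U _ _ fun_eq_refl] fun_eqD by metis
  from theI'[OF this] show "dz U R f \<in> carrier R" "is_derivative U f (dz U R f)"
    by (auto simp: dz_def)
qed

lemma dz_eqI:
  assumes f: "f \<in> carrier R" and g: "g \<in> carrier R"
    and h: "fun_eq U f h" and h': "is_derivative U h h'" and g_eq: "fun_eq U g h'"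
  shows "dz U R f = g"
proof (rule fun_eqD)
  have "fun_eq U (dz U R f) h'"
    by (rule is_derivative_unique[OF open_U dz_props(2)[OF f] h' h])
  then show "fun_eq U (dz U R f) g" using g_eq by (meson fun_eq_sym fun_eq_trans)
qed (use dz_props f g in auto)

text \<open>
  The product only shows that \<open>\<one>\<close> takes the values \<open>0\<close> and \<open>1\<close>; comparing with the element of \<open>R\<close>
  that represents the constant function \<open>1\<close> excludes the former.
\<close>

lemma one_eq: "fun_eq U \<one> (\<lambda>z. 1)"
proof -
  obtain e where e: "e \<in> carrier R" "fun_eq U e (\<lambda>z. 1)" using const_mem by blast
  have "fun_eq U (\<lambda>z. e z * \<one> z) (\<lambda>z. 1 * \<one> z)"
    by (rule fun_eq_op[OF e(2) fun_eq_refl, where op = "(*)"])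
  moreover have "fun_eq U e (\<lambda>z. e z * \<one> z)" using mult_eq[of e \<one>] e(1) by simp
  ultimately show ?thesis using e(2) by (simp, meson fun_eq_sym fun_eq_trans)
qed

lemma act_hom:
  assumes "\<gamma> \<in> \<Gamma>" shows "act U R \<gamma> \<in> ring_hom R R"
proof (rule ring_hom_memI)
  fix f g assume f: "f \<in> carrier R" and g: "g \<in> carrier R"
  note a = act_props[OF f assms] act_props[OF g assms]
  show "act U R \<gamma> (f \<oplus> g) = act U R \<gamma> f \<oplus> act U R \<gamma> g"
    by (rule act_eqI)
      (use a add_eq[OF a(1,3)] fun_eq_op[OF a(2,4), where op = "(+)"]
        fun_eq_homography[OF assms add_eq[OF f g]] in
        \<open>auto intro: fun_eq_trans fun_eq_sym\<close>)
  show "act U R \<gamma> (f \<otimes> g) = act U R \<gamma> f \<otimes> act U R \<gamma> g"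
    by (rule act_eqI)
      (use a mult_eq[OF a(1,3)] fun_eq_op[OF a(2,4), where op = "(*)"]
        fun_eq_homography[OF assms mult_eq[OF f g]] in
        \<open>auto intro: fun_eq_trans fun_eq_sym\<close>)
next
  show "act U R \<gamma> \<one> = \<one>"
    by (rule act_eqI) (use one_eq fun_eq_homography[OF assms one_eq] in
        \<open>auto intro: fun_eq_trans fun_eq_sym\<close>)
qed (use act_props assms in auto)

lemma dz_add:
  assumes f: "f \<in> carrier R" and g: "g \<in> carrier R"
  shows "dz U R (f \<oplus> g) = dz U R f \<oplus> dz U R g"
proof (rule dz_eqI[OF _ _ add_eq[OF f g]])
  let ?C = "{z \<in> U. \<not> (f has_field_derivative dz U R f z) (at z)} \<union>
    {z \<in> U. \<not> (g has_field_derivative dz U R g z) (at z)}"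
  have "countable ?C"
    using dz_props(2)[OF f] dz_props(2)[OF g] by (simp add: is_derivative_def)
  then show "is_derivative U (\<lambda>z. f z + g z) (\<lambda>z. dz U R f z + dz U R g z)"
    unfolding is_derivative_def
    by (rule countable_subset[rotated]) (auto intro: DERIV_add)
qed (use f g dz_props add_eq in auto)

lemma dz_mult:
  assumes f: "f \<in> carrier R" and g: "g \<in> carrier R"
  shows "dz U R (f \<otimes> g) = dz U R f \<otimes> g \<oplus> f \<otimes> dz U R g"
proof (rule dz_eqI[OF _ _ mult_eq[OF f g]])
  let ?C = "{z \<in> U. \<not> (f has_field_derivative dz U R f z) (at z)} \<union>
    {z \<in> U. \<not> (g has_field_derivative dz U R g z) (at z)}"
  have "countable ?C"
    using dz_props(2)[OF f] dz_props(2)[OF g] by (simp add: is_derivative_def)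
  then show "is_derivative U (\<lambda>z. f z * g z) (\<lambda>z. dz U R f z * g z + f z * dz U R g z)"
    unfolding is_derivative_def
    by (rule countable_subset[rotated]) (auto intro!: derivative_eq_intros)
  have c: "dz U R f \<in> carrier R" "dz U R g \<in> carrier R" using f g dz_props by auto
  show "fun_eq U (dz U R f \<otimes> g \<oplus> f \<otimes> dz U R g) (\<lambda>z. dz U R f z * g z + f z * dz U R g z)"
    using add_eq[of "dz U R f \<otimes> g" "f \<otimes> dz U R g"] f g c
      fun_eq_op[OF mult_eq[OF c(1) g] mult_eq[OF f c(2)], where op = "(+)"]
    by (auto intro: fun_eq_trans)
qed (use f g dz_props in auto)

definition aut_factor :: "complex^2^2 \<Rightarrow> complex \<Rightarrow> complex" where "aut_factor \<gamma> = elem_of U R (denom \<gamma>)"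

lemma aut_factor_unit: assumes "\<gamma> \<in> \<Gamma>" shows "aut_factor \<gamma> \<in> Units R"
proof -
  obtain g where "g \<in> Units R" "fun_eq U g (denom \<gamma>)" using denom_unit[OF assms] by blast
  then show ?thesis using elem_of_eq[of g "denom \<gamma>"] by (auto simp: aut_factor_def)
qed

lemma aut_factor_sq_eq: assumes "\<gamma> \<in> \<Gamma>" shows "fun_eq U (aut_factor \<gamma> [^] (2::nat)) (\<lambda>z. (denom \<gamma> z)\<^sup>2)"
proof -
  have j: "aut_factor \<gamma> \<in> carrier R" using aut_factor_unit[OF assms] by auto
  have "fun_eq U (aut_factor \<gamma>) (denom \<gamma>)"
    using elem_of_props(2)[of "denom \<gamma>"] denom_unit[OF assms] unfolding aut_factor_def by blast
  from fun_eq_op[OF this this, where op = "(*)"] mult_eq[OF j j] show ?thesis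
    using j by (simp add: numeral_2_eq_2) (rule fun_eq_trans)
qed

text \<open>
  The derivative of the homography is \<open>1 / (c z + d)^2\<close>, so this is the chain rule.
\<close>

lemma dz_act:
  assumes f: "f \<in> carrier R" and \<gamma>: "\<gamma> \<in> \<Gamma>"
  shows "aut_factor \<gamma> [^] (2::nat) \<otimes> dz U R (act U R \<gamma> f) = act U R \<gamma> (dz U R f)"
proof -
  let ?h = "homography \<gamma>" and ?d = "denom \<gamma>"
  have J: "aut_factor \<gamma> [^] (2::nat) \<in> carrier R" using aut_factor_unit[OF \<gamma>] by auto
  note af = act_props[OF f \<gamma>]
  note df = dz_props[OF f]
  note daf = dz_props[OF af(1)]
  let ?A = "{z \<in> U. \<not> (f has_field_derivative dz U R f z) (at z)}"
  let ?C = "{z \<in> U. ?h z \<notin> U} \<union> {z. ?h z \<in> ?A} \<union> {z. ?d z = 0}"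
  have "countable ?A" using df(2) by (simp add: is_derivative_def)
  from countable_homography_preimage[OF det_\<Gamma>[OF \<gamma>] this]
  have C: "countable ?C"
    by (intro countable_Un moebius_U[OF \<gamma>] countable_denom_zero[OF det_\<Gamma>[OF \<gamma>]])
  have "is_derivative U (\<lambda>z. f (?h z)) (\<lambda>z. dz U R f (?h z) * (1 / (?d z)\<^sup>2))"
    unfolding is_derivative_def
  proof (rule countable_subset[OF _ C], rule subsetI, rule ccontr)
    fix z assume z: "z \<in> {z \<in> U. \<not> ((\<lambda>z. f (?h z)) has_field_derivative
        dz U R f (?h z) * (1 / (?d z)\<^sup>2)) (at z)}" and "z \<notin> ?C"
    then have "(f has_field_derivative dz U R f (?h z)) (at (?h z))" "?d z \<noteq> 0" by auto
    from DERIV_chain2[OF this(1) homography_has_derivative[OF det_\<Gamma>[OF \<gamma>] this(2)]] z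
    show False by simp
  qed
  then have "fun_eq U (dz U R (act U R \<gamma> f)) (\<lambda>z. dz U R f (?h z) * (1 / (?d z)\<^sup>2))"
    by (rule is_derivative_unique[OF open_U daf(2) _ af(2)])
  then have "fun_eq U (\<lambda>z. (aut_factor \<gamma> [^] (2::nat)) z * dz U R (act U R \<gamma> f) z)
      (\<lambda>z. (?d z)\<^sup>2 * (dz U R f (?h z) * (1 / (?d z)\<^sup>2)))"
    by (rule fun_eq_op[OF aut_factor_sq_eq[OF \<gamma>], where op = "(*)"])
  moreover have "fun_eq U (\<lambda>z. (?d z)\<^sup>2 * (dz U R f (?h z) * (1 / (?d z)\<^sup>2))) (\<lambda>z. dz U R f (?h z))"
    by (rule fun_eq_subset[OF countable_denom_zero[OF det_\<Gamma>[OF \<gamma>]]]) simp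
  ultimately have "fun_eq U (aut_factor \<gamma> [^] (2::nat) \<otimes> dz U R (act U R \<gamma> f)) (\<lambda>z. dz U R f (?h z))"
    using mult_eq[OF J daf(1)] by (meson fun_eq_trans)
  then show ?thesis using act_eqI J daf(1) by (metis m_closed)
qed

text \<open>
  Modularity is an identity of functions off countable sets; it becomes an equation in the ring
  \<open>R\<close>, which is the form in which it is combined with the ring structure.
\<close>

lemma modular_forms_iff:
  assumes f: "f \<in> carrier R"
  shows "f \<in> modular_forms U R \<Gamma> 0 \<longleftrightarrow> (\<forall>\<gamma>\<in>\<Gamma>. act U R \<gamma> f = f)"
    and "f \<in> modular_forms U R \<Gamma> 2 \<longleftrightarrow> (\<forall>\<gamma>\<in>\<Gamma>. act U R \<gamma> f = aut_factor \<gamma> [^] (2::nat) \<otimes> f)"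
proof -
  have iff: "fun_eq U (\<lambda>z. f (homography \<gamma> z)) h \<longleftrightarrow> act U R \<gamma> f = g"
    if "\<gamma> \<in> \<Gamma>" "g \<in> carrier R" "fun_eq U g h" for \<gamma> g h
    using act_props[OF f that(1)] that(2,3) fun_eqD act_eqI
    by (meson fun_eq_sym fun_eq_trans)
  show "f \<in> modular_forms U R \<Gamma> 0 \<longleftrightarrow> (\<forall>\<gamma>\<in>\<Gamma>. act U R \<gamma> f = f)"
    using f iff[OF _ f fun_eq_refl] by (auto simp: modular_forms_def)
  have "fun_eq U (aut_factor \<gamma> [^] (2::nat) \<otimes> f) (\<lambda>z. denom \<gamma> z powi 2 * f z)" if "\<gamma> \<in> \<Gamma>" for \<gamma>
    using mult_eq[OF _ f, of "aut_factor \<gamma> [^] (2::nat)"] aut_factor_unit[OF that]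
      fun_eq_op[OF aut_factor_sq_eq[OF that] fun_eq_refl[of U f], where op = "(*)"]
    by (auto intro: fun_eq_trans)
  moreover have "aut_factor \<gamma> [^] (2::nat) \<otimes> f \<in> carrier R" if "\<gamma> \<in> \<Gamma>" for \<gamma>
    using aut_factor_unit[OF that] f by auto
  ultimately have "fun_eq U (\<lambda>z. f (homography \<gamma> z)) (\<lambda>z. denom \<gamma> z powi 2 * f z) \<longleftrightarrow>
      act U R \<gamma> f = aut_factor \<gamma> [^] (2::nat) \<otimes> f" if "\<gamma> \<in> \<Gamma>" for \<gamma>
    using that by (intro iff) auto
  then show "f \<in> modular_forms U R \<Gamma> 2 \<longleftrightarrow>
      (\<forall>\<gamma>\<in>\<Gamma>. act U R \<gamma> f = aut_factor \<gamma> [^] (2::nat) \<otimes> f)"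
    using f by (simp add: modular_forms_def)
qed

lemma modular_forms_0_eq:
  "modular_forms U R \<Gamma> 0 = {f \<in> carrier R. \<forall>\<gamma>\<in>\<Gamma>. act U R \<gamma> f = f}"
  using modular_forms_iff(1) by (auto simp: modular_forms_def)

lemma modular_forms_0_subring: "subring (modular_forms U R \<Gamma> 0) R"
proof (rule subringI)
  have act_minus: "act U R \<gamma> (\<ominus> f) = \<ominus> act U R \<gamma> f" if "\<gamma> \<in> \<Gamma>" "f \<in> carrier R" for \<gamma> f
  proof -
    interpret A: ring_hom_ring R R "act U R \<gamma>"
      by (intro ring_hom_ringI2 ring_axioms act_hom that)
    show ?thesis using that(2) by simp
  qed
  show "\<one> \<in> modular_forms U R \<Gamma> 0"
    by (simp add: modular_forms_0_eq ring_hom_one[OF act_hom])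
  show "\<ominus> f \<in> modular_forms U R \<Gamma> 0" if "f \<in> modular_forms U R \<Gamma> 0" for f
    using that by (simp add: modular_forms_0_eq act_minus)
qed (auto simp: modular_forms_0_eq ring_hom_mult[OF act_hom] ring_hom_add[OF act_hom])

end

section \<open>Invariants of the ring of pseudodifferential operators\<close>

lemma (in cring) scaled_derivation:
  assumes D: "skew_coefficients R D" and a: "a \<in> carrier R"
  shows "skew_coefficients R (\<lambda>f. a \<otimes> D f)"
proof -
  interpret D: skew_coefficients R D by fact
  show ?thesis
    by unfold_locales (use a in \<open>simp_all add: D.D_add D.D_mult r_distr m_ac\<close>)
qed

context modular_function_algebra
begin

abbreviation d where "d \<equiv> \<lambda>f. \<ominus> dz U R f"

lemma d_coefficients: "skew_coefficients R d"
proof unfold_locales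
  fix f g assume f: "f \<in> carrier R" and g: "g \<in> carrier R"
  then have c: "dz U R f \<in> carrier R" "dz U R g \<in> carrier R" by (simp_all add: dz_props)
  show "\<ominus> dz U R f \<in> carrier R" using c by simp
  show "\<ominus> dz U R (f \<oplus> g) = \<ominus> dz U R f \<oplus> \<ominus> dz U R g"
    using c f g by (simp add: dz_add minus_add)
  show "\<ominus> dz U R (f \<otimes> g) = \<ominus> dz U R f \<otimes> g \<oplus> f \<otimes> \<ominus> dz U R g"
    using c f g by (simp add: dz_mult minus_add l_minus r_minus)
qed

text \<open>
  The action is the substitution of \<open>(c z + d)^2 x^-1\<close> for \<open>x^-1\<close>, with \<open>\<gamma>\<close> acting on coefficients;
  the condition on derivations is the chain rule.
\<close>

lemma pdo_act_substitution:
  assumes \<gamma>: "\<gamma> \<in> \<Gamma>"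
  defines "w \<equiv> inv\<^bsub>pdo U R\<^esub> (act_xinv U R \<gamma>)"
  shows "skew_substitution R d R d (act U R \<gamma>) w"
    and "pdo_act U R \<gamma> = skew_substitution.subst R d (act U R \<gamma>) w"
    and "inv\<^bsub>pdo U R\<^esub> w = series_monom R (aut_factor \<gamma> [^] (2::nat)) (-1)"
proof -
  interpret d: skew_coefficients R d by (rule d_coefficients)
  interpret B: ring d.L by (rule d.skew_laurent_ring)
  have pow_unit: "aut_factor \<gamma> [^] (2::nat) \<in> Units R"
    using aut_factor_unit[OF \<gamma>] by (simp add: numeral_2_eq_2)
  have y: "act_xinv U R \<gamma> = series_monom R (aut_factor \<gamma> [^] (2::nat)) (-1)"
    by (simp add: act_xinv_def aut_factor_def)
  note inv = d.scaled_var_inverse[OF pow_unit]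
  show sub: "skew_substitution R d R d (act U R \<gamma>) w"
    unfolding w_def pdo_def y
  proof (rule skew_substitutionI[OF d_coefficients d_coefficients is_cring act_hom[OF \<gamma>] pow_unit])
    fix f assume f: "f \<in> carrier R"
    interpret A: ring_hom_ring R R "act U R \<gamma>"
      by (intro ring_hom_ringI2 ring_axioms act_hom \<gamma>)
    have "aut_factor \<gamma> [^] (2::nat) \<in> carrier R" using pow_unit by auto
    then show "aut_factor \<gamma> [^] (2::nat) \<otimes> d (act U R \<gamma> f) = act U R \<gamma> (d f)"
      using dz_act[OF f \<gamma>] f by (simp add: r_minus dz_props)
  qed
  then interpret S: skew_substitution R d R d "act U R \<gamma>" w .
  have pow: "act_xinv U R \<gamma> [^]\<^bsub>d.L\<^esub> (- n) = w [^]\<^bsub>d.L\<^esub> n" for n :: int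
    unfolding w_def pdo_def y by (rule B.Units_int_pow_neg[OF inv(1)])
  show "pdo_act U R \<gamma> = S.subst"
    by (rule ext) (simp add: pdo_act_def pdo_def S.subst_def S.subst_term_def[abs_def] pow)
  show "inv\<^bsub>pdo U R\<^esub> w = series_monom R (aut_factor \<gamma> [^] (2::nat)) (-1)"
    unfolding w_def pdo_def y using inv(1) by simp
qed

end

locale invertible_weight_two_form = modular_function_algebra +
  fixes chi
  assumes chi_weight: "chi \<in> modular_forms U R \<Gamma> 2" and chi_unit: "chi \<in> Units R"
begin

definition D where "D f = \<ominus> (inv chi \<otimes> dz U R f)"

definition u where
  "u = series_monom R \<one> 1 \<otimes>\<^bsub>pdo U R\<^esub> series_monom R chi 0"

abbreviation K where "K \<equiv> invariant_ring U R \<Gamma>"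

lemma chi_closed [simp]: "chi \<in> carrier R" "inv chi \<in> carrier R"
  using chi_unit by auto

lemma D_eq: "f \<in> carrier R \<Longrightarrow> D f = inv chi \<otimes> d f"
  by (simp add: D_def r_minus dz_props)

lemma D_coefficients: "skew_coefficients R D"
proof -
  interpret D': skew_coefficients R "\<lambda>f. inv chi \<otimes> d f"
    by (rule scaled_derivation[OF d_coefficients]) simp
  show ?thesis
    by unfold_locales (simp_all add: D_eq D'.D_add D'.D_mult D'.D_closed del: r_minus)
qed

sublocale d: skew_coefficients R d by (rule d_coefficients)

sublocale D: skew_coefficients R D by (rule D_coefficients)

sublocale B: ring "skew_laurent R d" by (rule d.skew_laurent_ring)

text \<open>
  This is where the weight is used: it says that \<open>u^-1 = \<chi>^-1 x^-1\<close> is invariant.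
\<close>

lemma act_inv_chi:
  assumes "\<gamma> \<in> \<Gamma>"
  shows "act U R \<gamma> (inv chi) \<otimes> aut_factor \<gamma> [^] (2::nat) = inv chi"
proof -
  let ?a = "act U R \<gamma>" and ?J = "aut_factor \<gamma> [^] (2::nat)"
  have J: "?J \<in> carrier R" using aut_factor_unit[OF assms] by auto
  have a: "?a (inv chi) \<in> carrier R" using act_props(1)[OF _ assms] by simp
  have "?a (inv chi) \<otimes> ?J \<otimes> chi = ?a (inv chi) \<otimes> ?a chi"
    using modular_forms_iff(2)[of chi] chi_weight assms J a by (simp add: m_assoc)
  also have "\<dots> = ?a (inv chi \<otimes> chi)"
    using ring_hom_mult[OF act_hom[OF assms]] by simp
  also have "\<dots> = \<one>" using chi_unit ring_hom_one[OF act_hom[OF assms]] by simp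
  finally have "chi \<otimes> (?a (inv chi) \<otimes> ?J) = \<one>" using J a by (simp add: m_comm)
  then show ?thesis using comm_inv_char[of chi "?a (inv chi) \<otimes> ?J"] J a by simp
qed

text \<open>
  The factors \<open>(c z + d)^2\<close> of \<open>\<chi>^-1\<close> and of \<open>d/dz\<close> cancel, so \<open>D\<close> commutes with the action.
\<close>

lemma act_D:
  assumes \<gamma>: "\<gamma> \<in> \<Gamma>" and f: "f \<in> carrier R"
  shows "act U R \<gamma> (D f) = inv chi \<otimes> d (act U R \<gamma> f)"
proof -
  let ?a = "act U R \<gamma>" and ?J = "aut_factor \<gamma> [^] (2::nat)"
  interpret A: ring_hom_ring R R ?a by (intro ring_hom_ringI2 ring_axioms act_hom \<gamma>)
  have J: "?J \<in> carrier R" using aut_factor_unit[OF \<gamma>] by auto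
  have "?a (D f) = \<ominus> (?a (inv chi) \<otimes> ?a (dz U R f))"
    using f by (simp add: D_def dz_props)
  also have "\<dots> = \<ominus> ((?a (inv chi) \<otimes> ?J) \<otimes> dz U R (?a f))"
    using J f by (simp add: dz_act[OF f \<gamma>, symmetric] dz_props m_assoc)
  finally show ?thesis
    using f by (simp add: act_inv_chi[OF \<gamma>] dz_props r_minus)
qed

lemma K_simps [simp]:
  "carrier K = modular_forms U R \<Gamma> 0" "\<zero>\<^bsub>K\<^esub> = \<zero>" "\<one>\<^bsub>K\<^esub> = \<one>"
  "a \<oplus>\<^bsub>K\<^esub> b = a \<oplus> b" "a \<otimes>\<^bsub>K\<^esub> b = a \<otimes> b"
  by (simp_all add: invariant_ring_def)

lemma D_invariant:
  assumes "f \<in> modular_forms U R \<Gamma> 0" shows "D f \<in> modular_forms U R \<Gamma> 0"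
  using assms act_D by (simp add: modular_forms_0_eq D_eq)

lemma K_coefficients: "skew_coefficients K D"
proof -
  interpret K: ring K
    unfolding invariant_ring_def by (rule subring_is_ring[OF modular_forms_0_subring])
  show ?thesis
    by unfold_locales
      (simp_all add: D_invariant, simp_all add: modular_forms_0_eq D.D_add D.D_mult)
qed

lemma u_eq: "u = inv\<^bsub>skew_laurent R d\<^esub> series_monom R (inv chi) (-1)"
  unfolding u_def pdo_def
  using d.scaled_var_inverse(2)[of "inv chi"] chi_unit by simp

lemma inv_u: "inv\<^bsub>skew_laurent R d\<^esub> u = series_monom R (inv chi) (-1)"
  unfolding u_eq using d.scaled_var_inverse(1)[of "inv chi"] chi_unit by simp

lemma u_substitution:
  assumes "skew_coefficients S D" "\<phi> \<in> ring_hom S R"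
    and "\<And>a. a \<in> carrier S \<Longrightarrow> inv chi \<otimes> d (\<phi> a) = \<phi> (D a)"
  shows "skew_substitution S D R d \<phi> u"
  unfolding u_eq
proof (rule skew_substitutionI[where S = S and D = D and T = R and E = d and \<phi> = \<phi> and v = "inv chi"])
  show "inv chi \<in> Units R" using chi_unit by simp
qed (use assms d_coefficients is_cring in blast)+

lemma expansion_substitution: "skew_substitution R D R d (\<lambda>f. f) u"
proof (rule u_substitution[where \<phi> = "\<lambda>f. f"])
  show "(\<lambda>f. f) \<in> ring_hom R R" by (simp add: ring_hom_def)
qed (simp_all add: D_coefficients D_eq)

lemma invariant_expansion_substitution: "skew_substitution K D R d (\<lambda>f. f) u"
proof (rule u_substitution[where \<phi> = "\<lambda>f. f"])
  show "(\<lambda>f. f) \<in> ring_hom K R" by (simp add: ring_hom_def modular_forms_0_eq)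
qed (simp_all add: K_coefficients D_eq modular_forms_0_eq)

sublocale E: skew_substitution R D R d "\<lambda>f. f" u
  by (rule expansion_substitution)

sublocale EK: skew_substitution K D R d "\<lambda>f. f" u
  by (rule invariant_expansion_substitution)

lemma expansion_eq: "expansion_term U R u = E.subst_term" "expansion U R u = E.subst"
proof -
  show t: "expansion_term U R u = E.subst_term"
    by (intro ext) (simp add: expansion_term_def E.subst_term_def pdo_def)
  show "expansion U R u = E.subst"
    by (intro ext) (simp add: expansion_def E.subst_def t)
qed

text \<open>
  The inverse of the expansion: as \<open>x^-1 = \<chi> u^-1\<close>, a series in \<open>x\<close> is rewritten as a series in
  \<open>u\<close> by substitution in the ring \<open>R((u; D))\<close>.
\<close>

definition x_in_u where
  "x_in_u = skew_substitution.subst R D (\<lambda>f. f) (inv\<^bsub>skew_laurent R D\<^esub> series_monom R chi (-1))"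

text \<open>
  Both composites fix the coefficients and send \<open>u^-1\<close> to \<open>\<chi>^-1 \<chi> u^-1\<close> and \<open>x^-1\<close> to
  \<open>\<chi> \<chi>^-1 x^-1\<close>, so they are the identity.
\<close>

lemma expansion_inverse:
  shows "f \<in> laurent_series R \<Longrightarrow> x_in_u (E.subst f) = f"
    and "b \<in> laurent_series R \<Longrightarrow> E.subst (x_in_u b) = b"
    and "b \<in> series_from R m \<Longrightarrow> x_in_u b \<in> series_from R m"
proof -
  let ?w = "inv\<^bsub>skew_laurent R D\<^esub> series_monom R chi (-1)"
  have comm: "chi \<otimes> D f = d f" if "f \<in> carrier R" for f
  proof -
    have "chi \<otimes> (inv chi \<otimes> d f) = (chi \<otimes> inv chi) \<otimes> d f"
      using that by (intro m_assoc[symmetric]) (simp_all add: dz_props)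
    then show ?thesis using that chi_unit by (simp add: D_eq dz_props)
  qed
  have "skew_substitution R d R D (\<lambda>f. f) ?w"
  proof (rule skew_substitutionI[where \<phi> = "\<lambda>f. f"])
    show "(\<lambda>f. f) \<in> ring_hom R R" by (simp add: ring_hom_def)
  qed (use d_coefficients D_coefficients is_cring chi_unit comm in blast)+
  then interpret I: skew_substitution R d R D "\<lambda>f. f" ?w .
  have inv_w: "inv\<^bsub>D.L\<^esub> ?w = series_monom R chi (-1)"
    using D.scaled_var_inverse(1)[OF chi_unit] by simp
  show "x_in_u b \<in> series_from R m" if "b \<in> series_from R m"
    unfolding x_in_u_def by (rule I.subst_from[OF that])
  show "x_in_u (E.subst f) = f" if f: "f \<in> laurent_series R"
    unfolding x_in_u_def
  proof (rule D.filtered_hom_eqI[where F = "\<lambda>f. I.subst (E.subst f)" and G = "\<lambda>f. f"])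
    show "filtered_additive R R (\<lambda>f. I.subst (E.subst f))"
      by (rule filtered_additive_compose[OF E.subst_filtered_additive I.subst_filtered_additive])
    show "(\<lambda>f. I.subst (E.subst f)) \<in> ring_hom D.L D.L"
      using ring_hom_trans[OF E.subst_hom I.subst_hom] by (simp add: comp_def)
    show "I.subst (E.subst (series_monom R \<one> (-1))) = series_monom R \<one> (-1)"
      using chi_unit by (simp add: E.subst_scaled_var[OF inv_u] I.subst_scaled_var[OF inv_w])
  qed (use f in \<open>simp_all add: E.subst_const I.subst_const filtered_additive_id
      ring_hom_def D_coefficients\<close>)
  show "E.subst (x_in_u b) = b" if b: "b \<in> laurent_series R"
    unfolding x_in_u_def
  proof (rule d.filtered_hom_eqI[where F = "\<lambda>f. E.subst (I.subst f)" and G = "\<lambda>f. f"])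
    show "filtered_additive R R (\<lambda>f. E.subst (I.subst f))"
      by (rule filtered_additive_compose[OF I.subst_filtered_additive E.subst_filtered_additive])
    show "(\<lambda>f. E.subst (I.subst f)) \<in> ring_hom d.L d.L"
      using ring_hom_trans[OF I.subst_hom E.subst_hom] by (simp add: comp_def)
    show "E.subst (I.subst (series_monom R \<one> (-1))) = series_monom R \<one> (-1)"
      using chi_unit by (simp add: E.subst_scaled_var[OF inv_u] I.subst_scaled_var[OF inv_w])
  qed (use b in \<open>simp_all add: E.subst_const I.subst_const filtered_additive_id
      ring_hom_def d_coefficients\<close>)
qed

text \<open>
  Both sides are values at \<open>f\<close> of homomorphisms on \<open>R((u; D))\<close> that act by \<open>\<gamma>\<close> on the constants and
  send \<open>u^-1\<close> to itself.
\<close>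

lemma pdo_act_expansion:
  assumes \<gamma>: "\<gamma> \<in> \<Gamma>" and f: "f \<in> laurent_series R"
  shows "pdo_act U R \<gamma> (E.subst f) = E.subst (\<lambda>i. act U R \<gamma> (f i))"
proof -
  let ?w = "inv\<^bsub>pdo U R\<^esub> (act_xinv U R \<gamma>)"
  interpret A: skew_substitution R d R d "act U R \<gamma>" ?w
    by (rule pdo_act_substitution(1)[OF \<gamma>])
  interpret V: skew_substitution R D R d "act U R \<gamma>" u
    by (rule u_substitution[OF D_coefficients act_hom[OF \<gamma>]]) (simp add: act_D[OF \<gamma>])
  have inv_w: "inv\<^bsub>d.L\<^esub> ?w = series_monom R (aut_factor \<gamma> [^] (2::nat)) (-1)"
    using pdo_act_substitution(3)[OF \<gamma>] by (simp add: pdo_def)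
  have J: "aut_factor \<gamma> [^] (2::nat) \<in> carrier R" using aut_factor_unit[OF \<gamma>] by auto
  have "A.subst (E.subst f) = V.subst f"
  proof (rule D.filtered_hom_eqI[where F = "\<lambda>f. A.subst (E.subst f)" and G = V.subst])
    show "filtered_additive R R (\<lambda>f. A.subst (E.subst f))"
      by (rule filtered_additive_compose[OF E.subst_filtered_additive A.subst_filtered_additive])
    show "(\<lambda>f. A.subst (E.subst f)) \<in> ring_hom D.L d.L"
      using ring_hom_trans[OF E.subst_hom A.subst_hom] by (simp add: comp_def)
    show "A.subst (E.subst (series_monom R \<one> (-1))) = V.subst (series_monom R \<one> (-1))"
      using J by (simp add: E.subst_scaled_var[OF inv_u] A.subst_scaled_var[OF inv_w]
          V.subst_scaled_var[OF inv_u] act_inv_chi[OF \<gamma>] ring_hom_one[OF act_hom[OF \<gamma>]])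
  qed (use f in \<open>simp_all add: E.subst_const A.subst_const V.subst_const d_coefficients
      V.subst_hom V.subst_filtered_additive\<close>)
  also have "V.subst f = E.subst (\<lambda>i. act U R \<gamma> (f i))"
    by (simp add: V.subst_def E.subst_def V.subst_term_def[abs_def] E.subst_term_def[abs_def])
  finally show ?thesis by (simp add: pdo_act_substitution(2)[OF \<gamma>])
qed

text \<open>
  The expansion is injective, so invariance can be read off from the coefficients.
\<close>

lemma invariant_iff:
  assumes f: "f \<in> laurent_series R"
  shows "(\<forall>\<gamma>\<in>\<Gamma>. pdo_act U R \<gamma> (E.subst f) = E.subst f) \<longleftrightarrow> f \<in> laurent_series K"
proof -
  have "pdo_act U R \<gamma> (E.subst f) = E.subst f \<longleftrightarrow> (\<forall>i. act U R \<gamma> (f i) = f i)"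
    if \<gamma>: "\<gamma> \<in> \<Gamma>" for \<gamma>
  proof -
    obtain m where "f \<in> series_from R m" using f by (rule laurent_seriesE)
    then have "(\<lambda>i. act U R \<gamma> (f i)) \<in> series_from R m"
      using act_props(1)[OF _ \<gamma>] ring_hom_zero[OF act_hom[OF \<gamma>] ring_axioms ring_axioms]
      by (simp add: series_from_def)
    then have "(\<lambda>i. act U R \<gamma> (f i)) \<in> laurent_series R" by (rule series_from_laurent)
    then have "E.subst (\<lambda>i. act U R \<gamma> (f i)) = E.subst f \<longleftrightarrow> (\<lambda>i. act U R \<gamma> (f i)) = f"
      using expansion_inverse(1) f by metis
    then show ?thesis by (simp add: pdo_act_expansion[OF \<gamma> f] fun_eq_iff)
  qed
  moreover have "f \<in> laurent_series K \<longleftrightarrow> (\<forall>i. f i \<in> modular_forms U R \<Gamma> 0)"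
    using f by (auto simp: laurent_series_def series_from_def)
  ultimately show ?thesis
    using series_coeff_closed[OF f] by (auto simp: modular_forms_0_eq)
qed

lemma laurent_series_K: "f \<in> laurent_series K \<Longrightarrow> f \<in> laurent_series R"
  by (auto simp: laurent_series_def series_from_def modular_forms_0_eq)

lemma pdo_invariants_carrier:
  "carrier (pdo_invariants U R \<Gamma>) = E.subst ` laurent_series K"
proof -
  have "b \<in> E.subst ` laurent_series K"
    if "b \<in> laurent_series R" "\<forall>\<gamma>\<in>\<Gamma>. pdo_act U R \<gamma> b = b" for b
  proof
    have x: "x_in_u b \<in> laurent_series R"
      using that(1) expansion_inverse(3) by (meson laurent_seriesE series_from_laurent)
    show b: "b = E.subst (x_in_u b)" using expansion_inverse(2)[OF that(1)] by simp
    show "x_in_u b \<in> laurent_series K" using invariant_iff[OF x] that(2) b by simp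
  qed
  moreover have "\<forall>\<gamma>\<in>\<Gamma>. pdo_act U R \<gamma> (E.subst f) = E.subst f" if "f \<in> laurent_series K" for f
    using invariant_iff[OF laurent_series_K[OF that]] that by simp
  ultimately show ?thesis
    by (auto simp: pdo_invariants_def pdo_def skew_laurent_simps laurent_series_K)
qed

lemma expansion_inj: "inj_on E.subst (laurent_series K)"
  by (rule inj_on_inverseI[where g = x_in_u]) (rule expansion_inverse(1)[OF laurent_series_K])

lemma expansion_iso:
  "E.subst \<in> ring_iso (skew_laurent K D) (pdo_invariants U R \<Gamma>)"
proof (rule ring_iso_memI)
  show "bij_betw E.subst (carrier (skew_laurent K D)) (carrier (pdo_invariants U R \<Gamma>))"
    using expansion_inj by (simp add: bij_betw_def pdo_invariants_carrier skew_laurent_simps)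
  fix f assume f: "f \<in> carrier (skew_laurent K D)"
  show "E.subst f \<in> carrier (pdo_invariants U R \<Gamma>)"
    using f by (simp add: pdo_invariants_carrier skew_laurent_simps(1))
  fix g assume g: "g \<in> carrier (skew_laurent K D)"
  show "E.subst (f \<otimes>\<^bsub>skew_laurent K D\<^esub> g) = E.subst f \<otimes>\<^bsub>pdo_invariants U R \<Gamma>\<^esub> E.subst g"
    unfolding ring_hom_mult[OF EK.subst_hom f g] by (simp add: pdo_invariants_def pdo_def)
  show "E.subst (f \<oplus>\<^bsub>skew_laurent K D\<^esub> g) = E.subst f \<oplus>\<^bsub>pdo_invariants U R \<Gamma>\<^esub> E.subst g"
    unfolding ring_hom_add[OF EK.subst_hom f g] by (simp add: pdo_invariants_def pdo_def)
next
  show "E.subst \<one>\<^bsub>skew_laurent K D\<^esub> = \<one>\<^bsub>pdo_invariants U R \<Gamma>\<^esub>"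
    unfolding ring_hom_one[OF EK.subst_hom] by (simp add: pdo_invariants_def pdo_def)
qed

text \<open>
  The expansion and its inverse both preserve the order of series.
\<close>

lemma expansion_iso0:
  "E.subst \<in> ring_iso (skew_power_series K D) (pdo0_invariants U R \<Gamma>)"
proof (rule ring_iso_memI)
  have low: "f \<in> series_from R 0 \<longleftrightarrow> (\<forall>i<0. f i = \<zero>)" if "f \<in> laurent_series R" for f
    using series_coeff_closed[OF that] by (simp add: series_from_def)
  have "carrier (skew_power_series K D) = {f \<in> laurent_series K. \<forall>i<0. f i = \<zero>}"
    by (simp add: skew_power_series_def skew_laurent_simps(1))
  then have K0: "carrier (skew_power_series K D) = laurent_series K \<inter> series_from R 0"
    using low laurent_series_K by blast
  have carriers: "carrier (pdo U R) = laurent_series R"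
    "carrier (pdo0 U R) = {b \<in> laurent_series R. \<forall>i<0. b i = \<zero>}"
    by (simp_all add: pdo_def pdo0_def skew_power_series_def skew_laurent_simps(1))
  have "carrier (pdo0_invariants U R \<Gamma>) =
      {b \<in> carrier (pdo0 U R). \<forall>\<gamma>\<in>\<Gamma>. pdo_act U R \<gamma> b = b}"
    "carrier (pdo_invariants U R \<Gamma>) =
      {b \<in> carrier (pdo U R). \<forall>\<gamma>\<in>\<Gamma>. pdo_act U R \<gamma> b = b}"
    by (simp_all add: pdo0_invariants_def pdo_invariants_def)
  then have R0: "carrier (pdo0_invariants U R \<Gamma>) = carrier (pdo_invariants U R \<Gamma>) \<inter> series_from R 0"
    unfolding carriers using low by blast
  have "E.subst ` (laurent_series K \<inter> series_from R 0) =
      E.subst ` laurent_series K \<inter> series_from R 0"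
  proof (intro equalityI subsetI)
    fix b assume "b \<in> E.subst ` laurent_series K \<inter> series_from R 0"
    then obtain f where f: "f \<in> laurent_series K" "b = E.subst f" "b \<in> series_from R 0" by blast
    then have "f \<in> series_from R 0"
      using expansion_inverse(1)[OF laurent_series_K[OF f(1)]] expansion_inverse(3)[OF f(3)] by simp
    then show "b \<in> E.subst ` (laurent_series K \<inter> series_from R 0)" using f by blast
  qed (use E.subst_from in blast)
  then show bij: "bij_betw E.subst (carrier (skew_power_series K D)) (carrier (pdo0_invariants U R \<Gamma>))"
    using inj_on_subset[OF expansion_inj]
    by (auto simp: bij_betw_def K0 R0 pdo_invariants_carrier)
  have from_laurent: "f \<in> carrier (skew_laurent K D)" if "f \<in> carrier (skew_power_series K D)" for f
    using that by (simp add: skew_power_series_def)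
  fix f assume f: "f \<in> carrier (skew_power_series K D)"
  show "E.subst f \<in> carrier (pdo0_invariants U R \<Gamma>)"
    using bij_betwE[OF bij] f by blast
  fix g assume g: "g \<in> carrier (skew_power_series K D)"
  show "E.subst (f \<otimes>\<^bsub>skew_power_series K D\<^esub> g) =
      E.subst f \<otimes>\<^bsub>pdo0_invariants U R \<Gamma>\<^esub> E.subst g"
    using ring_hom_mult[OF EK.subst_hom from_laurent from_laurent, OF f g]
    by (simp add: skew_power_series_def pdo0_invariants_def pdo0_def)
  show "E.subst (f \<oplus>\<^bsub>skew_power_series K D\<^esub> g) =
      E.subst f \<oplus>\<^bsub>pdo0_invariants U R \<Gamma>\<^esub> E.subst g"
    using ring_hom_add[OF EK.subst_hom from_laurent from_laurent, OF f g]
    by (simp add: skew_power_series_def pdo0_invariants_def pdo0_def)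
next
  show "E.subst \<one>\<^bsub>skew_power_series K D\<^esub> = \<one>\<^bsub>pdo0_invariants U R \<Gamma>\<^esub>"
    using ring_hom_one[OF EK.subst_hom]
    by (simp add: skew_power_series_def pdo0_invariants_def pdo0_def)
qed

lemma u_invariant: "u \<in> carrier (pdo_invariants U R \<Gamma>)"
proof -
  have "E.subst (series_monom R \<one> 1) = u"
    unfolding E.subst_var_pow by (rule B.Units_int_pow_1[OF E.w_unit])
  moreover have "series_monom R \<one> 1 \<in> laurent_series K"
  proof -
    have "series_monom R \<one> 1 = series_monom K \<one>\<^bsub>K\<^esub> 1" by (simp add: series_monom_def cong: if_cong)
    then show ?thesis using EK.S.series_monom_laurent[OF EK.S.one_closed] by metis
  qed
  ultimately show ?thesis unfolding pdo_invariants_carrier by (metis imageI)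
qed

end

theorem theorem2p4p1:
  fixes U :: "complex set"
    and R :: "(complex \<Rightarrow> complex) ring"
    and \<Gamma> :: "(complex^2^2) set"
    and chi :: "complex \<Rightarrow> complex"
    and u :: "int \<Rightarrow> complex \<Rightarrow> complex"
    and D :: "(complex \<Rightarrow> complex) \<Rightarrow> complex \<Rightarrow> complex"
  assumes "modular_function_algebra U R \<Gamma>"
    and "chi \<in> modular_forms U R \<Gamma> 2"
    and "chi \<in> Units R"
    and "u = series_monom R \<one>\<^bsub>R\<^esub> 1 \<otimes>\<^bsub>pdo U R\<^esub> series_monom R chi 0"
    and "D = (\<lambda>f. \<ominus>\<^bsub>R\<^esub> (inv\<^bsub>R\<^esub> chi \<otimes>\<^bsub>R\<^esub> dz U R f))"
  shows "u \<in> carrier (pdo_invariants U R \<Gamma>)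
    \<and> u \<in> Units (pdo U R)
    \<and> (\<forall>f \<in> carrier (invariant_ring U R \<Gamma>). D f \<in> carrier (invariant_ring U R \<Gamma>))
    \<and> (\<forall>f \<in> carrier (skew_laurent (invariant_ring U R \<Gamma>) D).
         series_summable R (expansion_term U R u f))
    \<and> expansion U R u
        \<in> ring_iso (skew_laurent (invariant_ring U R \<Gamma>) D) (pdo_invariants U R \<Gamma>)
    \<and> expansion U R u
        \<in> ring_iso (skew_power_series (invariant_ring U R \<Gamma>) D) (pdo0_invariants U R \<Gamma>)"
proof -
  interpret M: invertible_weight_two_form U R \<Gamma> chi
    by (intro invertible_weight_two_form.intro invertible_weight_two_form_axioms.intro assms)
  have D: "D = M.D" and u: "u = M.u"
    using assms(4,5) by (simp_all add: M.D_def[abs_def] M.u_def)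
  show ?thesis
    unfolding D u M.expansion_eq skew_laurent_simps(1) M.K_simps(1)
  proof (intro conjI ballI)
    show "M.u \<in> Units (pdo U R)" unfolding pdo_def by (rule M.E.w_unit)
    show "series_summable R (M.E.subst_term f)" if "f \<in> laurent_series (invariant_ring U R \<Gamma>)" for f
      by (rule M.E.subst_summable[OF M.laurent_series_K[OF that]])
  qed (fact M.u_invariant M.D_invariant M.expansion_iso M.expansion_iso0)+
qed

end
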